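(* Let $P_1,\dots,P_n$ be discrete probability measures on $\mathbb{R}^d$ and let $\lambda\in\mathbb{R}^n$ be a strictly positive weight vector with $\sum_{i=1}^n\lambda_i=1$. Let $\{1,\dots,|S^*|\}$ be partitioned into two index sets $(S^* )^y$ and $(S^* )^w$. The Discrete Barycenter Problem for $P_1,\dots,P_n$ and $\lambda$ can be solved using the following linear program (called LP (hybrid)) in the variables $w_h$ ($h\in(S^* )^w$), $y_{ijk}$ ($i=1,\dots,n$, $j=1,\dots,|P_i|$, $k\in S^y_{ij}$) and $z_k$ ($k\in K^y$): $$\begin{array}{rll} \min & \sum_{h\in(S^* )^w}c_hw_h+\sum_{i=1}^n\lambda_i\sum_{j=1}^{|P_i|}\sum_{k\in S^y_{ij}}\|\mathbf{x}_k-\mathbf{x}_{ij}\|^2y_{ijk} & \\ \text{s.t.} & \sum_{j:(i,j)\in S^y_k}y_{ijk}=z_k, & \forall i=1,\dots,n,\ \forall k\in K^y,\\ & \sum_{h\in(S^* )^w_{ij}}w_h+\sum_{k\in S^y_{ij}}y_{ijk}=d_{ij}, & \forall i=1,\dots,n,\ \forall j=1,\dots,|P_i|,\\ & w_h\ge0, & \forall h\in(S^* )^w,\\ & y_{ijk}\ge0, & \forall i=1,\dots,n,\ \forall j=1,\dots,|P_i|,\ \forall k\in S^y_{ij}. \end{array}$$ Moreover, any optimal vertex of this linear program corresponds to a sparse barycenter.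
   Context: Discrete measures: each $P_i$ is a probability measure on $\mathbb{R}^d$ with finite support $\mathrm{supp}(P_i)=\{\mathbf{x}_{ij} : j=1,\dots,|P_i|\}$ (distinct points; $|P_i|$ denotes the number of support points), with mass $d_{ij}>0$ at $\mathbf{x}_{ij}$ and $\sum_{j=1}^{|P_i|}d_{ij}=1$. Barycenter: $W_2$ denotes the quadratic Wasserstein distance, $W_2(\mu,\nu)^2=\inf_{\gamma\in\Pi(\mu,\nu)}\int\|x-y\|^2\,d\gamma(x,y)$, where $\Pi(\mu,\nu)$ is the set of measures on $\mathbb{R}^d\times\mathbb{R}^d$ with marginals $\mu,\nu$. A (discrete) barycenter of $P_1,\dots,P_n$ with weights $\lambda$ is a probability measure $\bar P$ on $\mathbb{R}^d$ minimizing $\sum_{i=1}^n\lambda_iW_2(P,P_i)^2$ over all probability measures $P$ on $\mathbb{R}^d$ with finite second moments. The Discrete Barycenter Problem asks, given $P_1,\dots,P_n$ and $\lambda$, for a barycenter. Sparse: a barycenter $\bar P$ is called sparse if $|\mathrm{supp}(\bar P)|\le\left(\sum_{i=1}^n|P_i|\right)-n+1$. Weighted means and tuples: $S^*=\mathrm{supp}(P_1)\times\dots\times\mathrm{supp}(P_n)=\{s^*_1,\dots,s^*_{|S^*|}\}$. For $s^*_h=(\mathbf{x}_{1j_1},\dots,\mathbf{x}_{nj_n})$ let $\mathbf{m}_h=\sum_{i=1}^n\lambda_i\mathbf{x}_{ij_i}$ be its weighted mean and $c_h=\sum_{i=1}^n\lambda_i\|\mathbf{m}_h-\mathbf{x}_{ij_i}\|^2$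 its cost. $S=\{\mathbf{m}_h : h\le|S^*|\}=\{\mathbf{x}_1,\dots,\mathbf{x}_{|S|}\}$ (distinct elements; several $h$ may have the same weighted mean). Index sets: $(S^* )^w_{ij}$ is the set of $h\in(S^* )^w$ such that the $i$-th component of $s^*_h$ is $\mathbf{x}_{ij}$. $S^y_{ij}$ is the set of indices $k$ such that $\mathbf{x}_k=\mathbf{m}_h$ for some $h\in(S^* )^y$ for which the $i$-th component of $s^*_h$ is $\mathbf{x}_{ij}$. $S^y_k$ is the set of pairs $(i,j)$ with $k\in S^y_{ij}$. $K^y=\bigcup_{i,j}S^y_{ij}$, i.e. the set of $k$ with $\mathbf{x}_k=\mathbf{m}_h$ for some $h\in(S^* )^y$. Meaning of the statement: "can be solved using the LP" means that the LP has an optimal solution and that for every optimal solution $(w,y,z)$ the measure $\bar P=\sum_{h\in(S^* )^w}w_h\delta_{\mathbf{m}_h}+\sum_{k\in K^y}z_k\delta_{\mathbf{x}_k}$ is a barycenter. An optimal vertex $(w,y,z)$ (an optimal solution that is a vertex of the feasible polyhedron) corresponds to this measure. *)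

theory Defs
  imports "HOL-Probability.Probability" "HOL-Analysis.Finite_Function_Topology"
begin

definition measure_support :: "'a::topological_space measure \<Rightarrow> 'a set" where
  "measure_support M = {p. \<forall>U. open U \<and> p \<in> U \<longrightarrow> emeasure M U > 0}"

definition borel_prob_measure :: "'a::topological_space measure \<Rightarrow> bool" where
  "borel_prob_measure M \<longleftrightarrow> sets M = sets borel \<and> prob_space M"

definition discrete_prob_measure :: "'a::topological_space measure \<Rightarrow> bool" where
  "discrete_prob_measure M \<longleftrightarrow> borel_prob_measure M \<and> finite (measure_support M)"

definition couplings :: "'a::euclidean_space measure \<Rightarrow> 'a measure \<Rightarrow> ('a \<times> 'a) measure set" where
  "couplings \<mu> \<nu> = {\<gamma>. sets \<gamma> = sets (borel \<Otimes>\<^sub>M borel) \<and> distr \<gamma> borel fst = \<mu> \<and> distr \<gamma> borel snd = \<nu>}"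

text \<open>The square of the quadratic Wasserstein distance, as an extended nonnegative real.\<close>

definition W2_squared :: "'a::euclidean_space measure \<Rightarrow> 'a measure \<Rightarrow> ennreal" where
  "W2_squared \<mu> \<nu> = (INF \<gamma>\<in>couplings \<mu> \<nu>. \<integral>\<^sup>+ p. ennreal ((norm (fst p - snd p))\<^sup>2) \<partial>\<gamma>)"

definition finite_second_moment :: "'a::euclidean_space measure \<Rightarrow> bool" where
  "finite_second_moment M \<longleftrightarrow> (\<integral>\<^sup>+ p. ennreal ((norm p)\<^sup>2) \<partial>M) < \<infinity>"

definition barycenter_objective ::
  "nat \<Rightarrow> (nat \<Rightarrow> 'a::euclidean_space measure) \<Rightarrow> (nat \<Rightarrow> real) \<Rightarrow> 'a measure \<Rightarrow> ennreal" where
  "barycenter_objective n P lam Q = (\<Sum>i=1..n. ennreal (lam i) * W2_squared Q (P i))"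

definition is_barycenter ::
  "nat \<Rightarrow> (nat \<Rightarrow> 'a::euclidean_space measure) \<Rightarrow> (nat \<Rightarrow> real) \<Rightarrow> 'a measure \<Rightarrow> bool" where
  "is_barycenter n P lam B \<longleftrightarrow>
     borel_prob_measure B \<and> finite_second_moment B \<and>
     (\<forall>Q. borel_prob_measure Q \<and> finite_second_moment Q \<longrightarrow>
        barycenter_objective n P lam B \<le> barycenter_objective n P lam Q)"

definition is_sparse_barycenter ::
  "nat \<Rightarrow> (nat \<Rightarrow> 'a::euclidean_space measure) \<Rightarrow> (nat \<Rightarrow> real) \<Rightarrow> 'a measure \<Rightarrow> bool" where
  "is_sparse_barycenter n P lam B \<longleftrightarrow>
     is_barycenter n P lam B \<and> finite (measure_support B) \<and>
     int (card (measure_support B)) \<le> (\<Sum>i=1..n. int (card (measure_support (P i)))) - int n + 1"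

text \<open>Elements of the product of the supports are functions on \<open>{1..n}\<close>, extended by
  \<^const>\<open>undefined\<close> outside.\<close>

definition support_tuples :: "nat \<Rightarrow> (nat \<Rightarrow> 'a::euclidean_space measure) \<Rightarrow> (nat \<Rightarrow> 'a) set" where
  "support_tuples n P = (\<Pi>\<^sub>E i\<in>{1..n}. measure_support (P i))"

definition weighted_mean :: "nat \<Rightarrow> (nat \<Rightarrow> real) \<Rightarrow> (nat \<Rightarrow> 'a::euclidean_space) \<Rightarrow> 'a" where
  "weighted_mean n lam t = (\<Sum>i=1..n. lam i *\<^sub>R t i)"

definition tuple_cost :: "nat \<Rightarrow> (nat \<Rightarrow> real) \<Rightarrow> (nat \<Rightarrow> 'a::euclidean_space) \<Rightarrow> real" where
  "tuple_cost n lam t = (\<Sum>i=1..n. lam i * (norm (weighted_mean n lam t - t i))\<^sup>2)"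

definition weighted_means ::
  "nat \<Rightarrow> (nat \<Rightarrow> 'a::euclidean_space measure) \<Rightarrow> (nat \<Rightarrow> real) \<Rightarrow> 'a set" where
  "weighted_means n P lam = weighted_mean n lam ` support_tuples n P"

text \<open>
  A point \<open>(w, y, z)\<close> of the space of the linear program. Finitely supported functions form a real
  vector space; requiring their keys to lie in the (finite) index sets of the variables identifies
  the ambient space of the program with a coordinate subspace, so that vertices can be expressed
  by \<^const>\<open>extreme_point_of\<close>.
\<close>

type_synonym lp_point =
  "(nat \<Rightarrow>\<^sub>0 real) \<times> (nat \<times> nat \<times> nat \<Rightarrow>\<^sub>0 real) \<times> (nat \<Rightarrow>\<^sub>0 real)"

text \<open>
  \<open>x i\<close> enumerates the support of \<open>P i\<close>, \<open>s\<close> the tuples in the product of the supports, and \<open>X\<close>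
  the distinct weighted means, all starting from index 1; these requirements are assumptions of
  the theorem and not of the locale. \<open>Hw\<close> and \<open>Hy\<close> are the two parts of the index set of \<open>s\<close>.
\<close>

locale hybrid_lp =
  fixes n :: nat
    and P :: "nat \<Rightarrow> 'a::euclidean_space measure"
    and lam :: "nat \<Rightarrow> real"
    and x :: "nat \<Rightarrow> nat \<Rightarrow> 'a"
    and s :: "nat \<Rightarrow> nat \<Rightarrow> 'a"
    and X :: "nat \<Rightarrow> 'a"
    and Hw Hy :: "nat set"
begin

definition J :: "nat \<Rightarrow> nat set" where
  "J i = {1..card (measure_support (P i))}"

definition d :: "nat \<Rightarrow> nat \<Rightarrow> real" where
  "d i j = measure (P i) {x i j}"

definition Sw :: "nat \<Rightarrow> nat \<Rightarrow> nat set" where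
  "Sw i j = {h \<in> Hw. s h i = x i j}"

definition Sy :: "nat \<Rightarrow> nat \<Rightarrow> nat set" where
  "Sy i j = {k \<in> {1..card (weighted_means n P lam)}.
               \<exists>h\<in>Hy. X k = weighted_mean n lam (s h) \<and> s h i = x i j}"

definition Sy_pairs :: "nat \<Rightarrow> (nat \<times> nat) set" where
  "Sy_pairs k = {(i, j). i \<in> {1..n} \<and> j \<in> J i \<and> k \<in> Sy i j}"

definition Ky :: "nat set" where
  "Ky = (\<Union>i\<in>{1..n}. \<Union>j\<in>J i. Sy i j)"

definition y_index :: "(nat \<times> nat \<times> nat) set" where
  "y_index = {(i, j, k). i \<in> {1..n} \<and> j \<in> J i \<and> k \<in> Sy i j}"

definition objective :: "lp_point \<Rightarrow> real" where
  "objective = (\<lambda>(w, y, z).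
     (\<Sum>h\<in>Hw. tuple_cost n lam (s h) * Poly_Mapping.lookup w h)
     + (\<Sum>i=1..n. lam i * (\<Sum>j\<in>J i. \<Sum>k\<in>Sy i j.
          (norm (X k - x i j))\<^sup>2 * Poly_Mapping.lookup y (i, j, k))))"

definition feasible :: "lp_point set" where
  "feasible = {(w, y, z).
     Poly_Mapping.keys w \<subseteq> Hw \<and> Poly_Mapping.keys y \<subseteq> y_index \<and> Poly_Mapping.keys z \<subseteq> Ky \<and>
     (\<forall>i\<in>{1..n}. \<forall>k\<in>Ky.
        (\<Sum>j | (i, j) \<in> Sy_pairs k. Poly_Mapping.lookup y (i, j, k)) = Poly_Mapping.lookup z k) \<and>
     (\<forall>i\<in>{1..n}. \<forall>j\<in>J i.
        (\<Sum>h\<in>Sw i j. Poly_Mapping.lookup w h)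
        + (\<Sum>k\<in>Sy i j. Poly_Mapping.lookup y (i, j, k)) = d i j) \<and>
     (\<forall>h\<in>Hw. Poly_Mapping.lookup w h \<ge> 0) \<and>
     (\<forall>i\<in>{1..n}. \<forall>j\<in>J i. \<forall>k\<in>Sy i j. Poly_Mapping.lookup y (i, j, k) \<ge> 0)}"

definition optimal :: "lp_point \<Rightarrow> bool" where
  "optimal v \<longleftrightarrow> v \<in> feasible \<and> (\<forall>u\<in>feasible. objective v \<le> objective u)"

definition optimal_vertex :: "lp_point \<Rightarrow> bool" where
  "optimal_vertex v \<longleftrightarrow> optimal v \<and> v extreme_point_of feasible"

text \<open>
  The measure with an atom of mass \<open>w h\<close> at the weighted mean of \<open>s h\<close> for \<open>h \<in> Hw\<close> and an atom of
  mass \<open>z k\<close> at \<open>X k\<close> for \<open>k \<in> Ky\<close> (masses of coinciding points add up). The application of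
  \<^const>\<open>ennreal\<close> does not affect feasible points: there \<open>w\<close> is nonnegative, and so is \<open>z\<close>
  when \<open>n \<ge> 1\<close>, its entries being sums of entries of \<open>y\<close>.
\<close>

definition lp_measure :: "lp_point \<Rightarrow> 'a measure" where
  "lp_measure = (\<lambda>(w, y, z). measure_of UNIV (sets borel)
     (\<lambda>A. (\<Sum>h\<in>Hw. ennreal (Poly_Mapping.lookup w h)
                     * emeasure (return borel (weighted_mean n lam (s h))) A)
        + (\<Sum>k\<in>Ky. ennreal (Poly_Mapping.lookup z k) * emeasure (return borel (X k)) A)))"

lemma sets_lp_measure [simp]: "sets (lp_measure v) = sets borel"
  by (simp add: lp_measure_def split_beta)
    (metis sets.sigma_sets_eq space_borel)

lemma emeasure_lp_measure:
  assumes "A \<in> sets borel"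
  shows "emeasure (lp_measure (w, y, z)) A =
           (\<Sum>h\<in>Hw. ennreal (Poly_Mapping.lookup w h)
                     * emeasure (return borel (weighted_mean n lam (s h))) A)
           + (\<Sum>k\<in>Ky. ennreal (Poly_Mapping.lookup z k) * emeasure (return borel (X k)) A)"
    (is "_ = ?f A")
proof -
  have "countably_additive (sets borel) ?f"
    by (auto simp: countably_additive_def suminf_add[symmetric] suminf_sum ennreal_suminf_cmult
        suminf_indicator intro!: arg_cong2[where f = "(+)"] sum.cong)
  then have "emeasure (measure_of UNIV (sets borel) ?f) A = ?f A"
    using assms sets.sigma_algebra_axioms[of "borel :: 'a measure"]
    by (intro emeasure_measure_of_sigma) (auto simp: positive_def)
  then show ?thesis
    by (simp add: lp_measure_def)
qed

end

end

theory Submission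
  imports Defs
begin

text \<open>
  Let \<open>C\<close> be the least value of \<open>\<Sum>t. c t * W t\<close> over the multimarginal weights \<open>W\<close> on the tuples, i.e.
  those whose \<open>i\<close>-th marginal is \<open>P i\<close>; it is attained by compactness.

  For every \<open>Q\<close> the barycenter objective at \<open>Q\<close> is at least \<open>C\<close>: each \<open>P i\<close> is finitely supported, so a
  coupling of \<open>Q\<close> and \<open>P i\<close> disintegrates, by Radon--Nikodym, into densities \<open>f i q\<close> with \<open>(\<Sum>q. f i q) = 1\<close>;
  gluing couplings by \<open>W t = (\<integral>\<Prod>i. f i (t i) dQ)\<close> gives multimarginal weights of no larger cost,
  because the weighted mean minimizes the weighted sum of squared distances. For every feasible \<open>v\<close>
  the objective at \<open>lp_measure v\<close> is at most the LP objective, by the coupling that can be read off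
  \<open>v\<close>. Finally a minimizing \<open>W\<close> induces a feasible \<open>v\<close> of the same cost, so \<open>C\<close> is also the LP optimum.

  Sparsity: if \<open>w\<close> and \<open>z\<close> have too many positive entries, the mass constraints leave room for a
  nontrivial perturbation of the solution in both directions, so it is not a vertex.
\<close>

section \<open>Linear systems, sums and infima\<close>

text \<open>Gaussian elimination by induction on the equations: an equation with only zero
  coefficients is dropped; any other one serves to eliminate one unknown \<open>v\<close>, which
  removes one equation and one unknown and so keeps the strict inequality.\<close>

lemma ex_nontrivial_solution:
  fixes a :: "'e \<Rightarrow> 'u \<Rightarrow> real"
  assumes "finite E" "finite U" "card E < card U"
  shows "\<exists>r. (\<forall>e\<in>E. (\<Sum>u\<in>U. a e u * r u) = 0) \<and> (\<exists>u\<in>U. r u \<noteq> 0)"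
  using assms
proof (induction E arbitrary: U a rule: finite_induct)
  case empty
  then have "U \<noteq> {}" by auto
  then show ?case by (intro exI[of _ "\<lambda>_. 1"]) auto
next
  case (insert e E)
  show ?case
  proof (cases "\<forall>u\<in>U. a e u = 0")
    case True
    with insert.IH[of U a] insert.prems insert.hyps show ?thesis by simp
  next
    case False
    then obtain v where v: "v \<in> U" "a e v \<noteq> 0" by blast
    \<comment> \<open>Subtracting the multiple \<open>a e' v / a e v\<close> of equation
      \<open>e\<close> makes the coefficient of \<open>v\<close> in equation \<open>e'\<close>
      vanish.\<close>
    define b where "b = (\<lambda>e' u. a e' u - a e' v * a e u / a e v)"
    have "card E < card (U - {v})"
      using insert.prems insert.hyps v by simp
    then obtain r where r: "\<And>e'. e' \<in> E \<Longrightarrow> (\<Sum>u\<in>U - {v}. b e' u * r u) = 0"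
      and nz: "\<exists>u\<in>U - {v}. r u \<noteq> 0"
      using insert.IH[of "U - {v}" b] insert.prems by auto
    \<comment> \<open>Equation \<open>e\<close> forces the value \<open>- c\<close> at
      \<open>v\<close> once the other unknowns are given.\<close>
    define c where "c = (\<Sum>u\<in>U - {v}. a e u * r u) / a e v"
    define r' where "r' = r(v := - c)"
    have split: "(\<Sum>u\<in>U. a e' u * r' u) = (\<Sum>u\<in>U - {v}. a e' u * r u) - a e' v * c" for e'
      using v insert.prems by (simp add: sum.remove[of U v] r'_def)
    have "(\<Sum>u\<in>U. a e' u * r' u) = 0" if "e' \<in> E" for e'
    proof -
      have "(\<Sum>u\<in>U - {v}. b e' u * r u)
          = (\<Sum>u\<in>U - {v}. a e' u * r u) - a e' v * c"
        by (simp add: b_def c_def left_diff_distrib sum_subtractf sum_distrib_left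
            sum_divide_distrib mult.assoc)
      with r[OF that] show ?thesis by (simp add: split)
    qed
    moreover have "(\<Sum>u\<in>U. a e u * r' u) = 0"
      using v by (simp add: split c_def)
    moreover have "\<exists>u\<in>U. r' u \<noteq> 0"
      using nz by (auto simp: r'_def)
    ultimately show ?thesis by blast
  qed
qed

text \<open>A homogeneous system allows rescaling, here by the sum of the absolute values. The bound
  makes \<open>1 + r u\<close> and \<open>1 - r u\<close> nonnegative when \<open>r\<close> is used
  as a relative perturbation.\<close>

corollary ex_nontrivial_solution_le_1:
  fixes a :: "'e \<Rightarrow> 'u \<Rightarrow> real"
  assumes "finite E" "finite U" "card E < card U"
  shows "\<exists>r. (\<forall>e\<in>E. (\<Sum>u\<in>U. a e u * r u) = 0) \<and> (\<exists>u\<in>U. r u \<noteq> 0) \<and> (\<forall>u\<in>U. \<bar>r u\<bar> \<le> 1)"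
proof -
  obtain r where r: "\<And>e. e \<in> E \<Longrightarrow> (\<Sum>u\<in>U. a e u * r u) = 0" and nz: "\<exists>u\<in>U. r u \<noteq> 0"
    using ex_nontrivial_solution[OF assms, of a] by blast
  define m where "m = (\<Sum>u\<in>U. \<bar>r u\<bar>)"
  have le: "\<bar>r u\<bar> \<le> m" if "u \<in> U" for u
    unfolding m_def using assms(2) that by (intro member_le_sum) auto
  with nz have "m > 0" by fastforce
  have "(\<Sum>u\<in>U. a e u * (r u / m)) = 0" if "e \<in> E" for e
    using r[OF that] by (simp flip: sum_divide_distrib)
  with nz le \<open>m > 0\<close> show ?thesis
    by (intro exI[of _ "\<lambda>u. r u / m"]) auto
qed

text \<open>The marginals of a product weight are its factors: \<open>g (t i)\<close> is absorbed
  into the \<open>i\<close>-th factor, the sum over \<open>PiE I B\<close> factorizes, and every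
  other factor sums to 1. The general semiring covers both \<open>ennreal\<close> densities and real
  masses.\<close>

lemma sum_prod_PiE_marginal:
  fixes f :: "'i \<Rightarrow> 'b \<Rightarrow> 'c :: comm_semiring_1"
  assumes I: "finite I" and B: "\<And>i. i \<in> I \<Longrightarrow> finite (B i)"
    and f: "\<And>i. i \<in> I \<Longrightarrow> (\<Sum>b\<in>B i. f i b) = 1" and i: "i \<in> I"
  shows "(\<Sum>t\<in>PiE I B. (\<Prod>l\<in>I. f l (t l)) * g (t i)) = (\<Sum>b\<in>B i. f i b * g b)"
proof -
  have "(\<Sum>t\<in>PiE I B. (\<Prod>l\<in>I. f l (t l)) * g (t i))
      = (\<Sum>t\<in>PiE I B. \<Prod>l\<in>I. f l (t l) * (if l = i then g (t l) else 1))"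
    using I i by (simp add: prod.distrib)
  also have "\<dots> = (\<Prod>l\<in>I. \<Sum>b\<in>B l. f l b * (if l = i then g b else 1))"
    by (rule prod_sum_PiE[symmetric]) (use I B in auto)
  also have "\<dots> = (\<Prod>l\<in>I. if l = i then \<Sum>b\<in>B i. f i b * g b else 1)"
    by (rule prod.cong) (auto simp: f)
  also have "\<dots> = (\<Sum>b\<in>B i. f i b * g b)"
    using I i by simp
  finally show ?thesis .
qed

text \<open>The members of the \<open>A i\<close> are chosen independently, so near-minimizers in
  all summands together approximate the right-hand side. An infinite infimum has positive weight and
  makes the right-hand side infinite.\<close>

lemma le_sum_INF_ennreal:
  fixes F :: "'i \<Rightarrow> 'b \<Rightarrow> ennreal"
  assumes I: "finite I"
    and le: "\<And>g. (\<And>i. i \<in> I \<Longrightarrow> g i \<in> A i) \<Longrightarrow> c \<le> (\<Sum>i\<in>I. ennreal (a i) * F i (g i))"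
    and a: "\<And>i. i \<in> I \<Longrightarrow> a i > 0"
  shows "c \<le> (\<Sum>i\<in>I. ennreal (a i) * (INF b\<in>A i. F i b))"
proof (cases "\<exists>i\<in>I. (INF b\<in>A i. F i b) = \<infinity>")
  case True
  then obtain i where i: "i \<in> I" "(INF b\<in>A i. F i b) = top" by auto
  then have "ennreal (a i) * (INF b\<in>A i. F i b) = top"
    using a[of i] by (simp add: ennreal_mult_eq_top_iff)
  moreover have "ennreal (a i) * (INF b\<in>A i. F i b) \<le> (\<Sum>i\<in>I. ennreal (a i) * (INF b\<in>A i. F i b))"
    using I i by (intro member_le_sum) auto
  ultimately have "(\<Sum>i\<in>I. ennreal (a i) * (INF b\<in>A i. F i b)) = top"
    by (simp add: top_unique)
  then show ?thesis by simp
next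
  case False
  show ?thesis
  proof (rule ennreal_le_epsilon)
    fix e :: real assume e: "e > 0"
    \<comment> \<open>Chosen so that the weighted errors \<open>a i * \<delta>\<close> add up to
      exactly \<open>e\<close>; the sum of the \<open>a i\<close> is positive only for nonempty
      \<open>I\<close>, hence the case split.\<close>
    define \<delta> where "\<delta> = e / (\<Sum>i\<in>I. a i)"
    show "c \<le> (\<Sum>i\<in>I. ennreal (a i) * (INF b\<in>A i. F i b)) + ennreal e"
    proof (cases "I = {}")
      case True
      with le show ?thesis by auto
    next
      case False
      have pos: "(\<Sum>i\<in>I. a i) > 0"
        by (rule sum_pos[OF I False a])
      then have \<delta>: "\<delta> > 0" using e by (simp add: \<delta>_def)
      have "\<exists>b\<in>A i. F i b < (INF b\<in>A i. F i b) + ennreal \<delta>" if "i \<in> I" for i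
        using \<delta> that \<open>\<not> (\<exists>i\<in>I. (INF b\<in>A i. F i b) = \<infinity>)\<close>
        by (intro INF_approx_ennreal) auto
      then obtain g where g: "\<And>i. i \<in> I \<Longrightarrow> g i \<in> A i"
        "\<And>i. i \<in> I \<Longrightarrow> F i (g i) < (INF b\<in>A i. F i b) + ennreal \<delta>"
        by metis
      have "c \<le> (\<Sum>i\<in>I. ennreal (a i) * F i (g i))"
        by (rule le) (rule g)
      also have "\<dots> \<le> (\<Sum>i\<in>I. ennreal (a i) * ((INF b\<in>A i. F i b) + ennreal \<delta>))"
        by (intro sum_mono mult_left_mono less_imp_le[OF g(2)]) auto
      also have "\<dots> = (\<Sum>i\<in>I. ennreal (a i) * (INF b\<in>A i. F i b)) + (\<Sum>i\<in>I. ennreal (a i) * ennreal \<delta>)"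
        by (simp add: distrib_left sum.distrib)
      also have "(\<Sum>i\<in>I. ennreal (a i) * ennreal \<delta>) = ennreal (\<Sum>i\<in>I. a i * \<delta>)"
        using less_imp_le[OF a] \<delta> by (simp add: ennreal_mult flip: sum_ennreal)
      also have "(\<Sum>i\<in>I. a i * \<delta>) = e"
        using pos by (simp add: \<delta>_def flip: sum_distrib_right sum_divide_distrib)
      finally show ?thesis .
    qed
  qed
qed

text \<open>Expanding the squares around the weighted mean \<open>m\<close>, the cross terms cancel
  because the weights sum to 1; the two sides differ by the squared distance of \<open>p\<close> and
  \<open>m\<close>.\<close>

lemma sum_weighted_dist_ge_tuple_cost:
  assumes lam: "\<And>i. i \<in> {1..n} \<Longrightarrow> lam i \<ge> 0" and sum: "(\<Sum>i=1..n. lam i) = 1"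
  shows "tuple_cost n lam t \<le> (\<Sum>i=1..n. lam i * (norm (p - t i))\<^sup>2)"
proof -
  define m where "m = weighted_mean n lam t"
  have eq: "lam i * (norm (p - t i))\<^sup>2 = lam i * (norm (p - m))\<^sup>2 + lam i * (norm (m - t i))\<^sup>2
      + 2 * ((p - m) \<bullet> (lam i *\<^sub>R (m - t i)))" for i
  proof -
    have "(norm (p - t i))\<^sup>2 = (norm ((p - m) + (m - t i)))\<^sup>2" by simp
    also have "\<dots> = (norm (p - m))\<^sup>2 + (norm (m - t i))\<^sup>2 + 2 * ((p - m) \<bullet> (m - t i))"
      by (simp only: power2_norm_eq_inner inner_add_left inner_add_right inner_commute)
    finally have "lam i * (norm (p - t i))\<^sup>2 = lam i * ((norm (p - m))\<^sup>2 + (norm (m - t i))\<^sup>2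
        + 2 * ((p - m) \<bullet> (m - t i)))"
      by simp
    then show ?thesis
      by (simp only: distrib_left inner_scaleR_right mult.left_commute)
  qed
  have "(\<Sum>i=1..n. lam i *\<^sub>R (m - t i)) = 0"
    using sum by (simp add: scaleR_diff_right sum_subtractf m_def weighted_mean_def
        flip: scaleR_sum_left)
  then have "(\<Sum>i=1..n. (p - m) \<bullet> (lam i *\<^sub>R (m - t i))) = 0"
    by (simp only: inner_sum_right[symmetric] inner_zero_right)
  then have "(\<Sum>i=1..n. lam i * (norm (p - t i))\<^sup>2)
      = (norm (p - m))\<^sup>2 + (\<Sum>i=1..n. lam i * (norm (m - t i))\<^sup>2)"
    using sum by (simp add: eq sum.distrib flip: sum_distrib_left sum_distrib_right del: inner_scaleR_right)
  then show ?thesis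
    by (simp add: tuple_cost_def m_def)
qed

section \<open>Finitely supported measures\<close>

text \<open>The complement is a union of possibly uncountably many open null sets; a countable basis
  reduces it to countably many.\<close>

lemma compl_measure_support_in_null_sets:
  fixes M :: "'a::second_countable_topology measure"
  assumes "sets M = sets borel"
  shows "- measure_support M \<in> null_sets M"
proof -
  define \<B> where "\<B> = (SOME B::'a set set. countable B \<and> topological_basis B)"
  have \<B>: "countable \<B>" "topological_basis \<B>"
    using someI_ex[OF ex_countable_basis] by (auto simp: \<B>_def)
  have "- measure_support M = \<Union> {U \<in> \<B>. emeasure M U = 0}"
  proof (intro equalityI subsetI)
    fix p assume "p \<in> - measure_support M"
    then obtain U where U: "open U" "p \<in> U" "emeasure M U = 0"
      by (auto simp: measure_support_def)
    then obtain V where "V \<in> \<B>" "p \<in> V" "V \<subseteq> U"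
      using topological_basisE[OF \<B>(2)] by metis
    moreover from this have "emeasure M V = 0"
      using U assms emeasure_mono[of V U M] by auto
    ultimately show "p \<in> \<Union> {U \<in> \<B>. emeasure M U = 0}" by blast
  next
    fix p assume "p \<in> \<Union> {U \<in> \<B>. emeasure M U = 0}"
    then show "p \<in> - measure_support M"
      using topological_basis_open[OF \<B>(2)] by (auto simp: measure_support_def)
  qed
  also have "\<dots> = (\<Union>U\<in>{U \<in> \<B>. emeasure M U = 0}. U)"
    by simp
  also have "\<dots> \<in> null_sets M"
    using \<B>(1) topological_basis_open[OF \<B>(2)] assms
    by (intro null_sets_UN') (auto simp: null_sets_def)
  finally show ?thesis .
qed

text \<open>Taking the image of a point measure on the indices leaves \<open>p\<close> arbitrary:
  masses at coinciding points add up, and a push-forward merely composes with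
  \<open>p\<close>.\<close>

definition atomic :: "'i set \<Rightarrow> ('i \<Rightarrow> real) \<Rightarrow> ('i \<Rightarrow> 'a) \<Rightarrow> 'a::topological_space measure" where
  "atomic I a p = distr (point_measure I (\<lambda>i. ennreal (a i))) borel p"

lemma sets_atomic [simp, measurable_cong]: "sets (atomic I a p) = sets borel"
  by (simp add: atomic_def)

lemma space_atomic [simp]: "space (atomic I a p) = UNIV"
  by (simp add: atomic_def)

lemma nn_integral_atomic:
  assumes "finite I" "f \<in> borel_measurable borel"
  shows "(\<integral>\<^sup>+ q. f q \<partial>atomic I a p) = (\<Sum>i\<in>I. ennreal (a i) * f (p i))"
  using assms by (simp add: atomic_def nn_integral_distr nn_integral_point_measure_finite)

lemma emeasure_atomic:
  assumes "finite I" "A \<in> sets borel"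
  shows "emeasure (atomic I a p) A = (\<Sum>i\<in>I. ennreal (a i) * indicator A (p i))"
  using nn_integral_atomic[OF assms(1), of "indicator A" a p] assms(2) by simp

lemma distr_atomic:
  assumes "f \<in> borel_measurable borel"
  shows "distr (atomic I a p) borel f = atomic I a (f \<circ> p)"
  using assms by (simp add: atomic_def distr_distr)

text \<open>The complement of the finite support is a null set, so the measure of a set is the sum
  of the point masses at the support points in it.\<close>

lemma discrete_prob_measure_eq_atomic:
  fixes M :: "'a::euclidean_space measure"
  assumes "discrete_prob_measure M" "bij_betw q I (measure_support M)"
  shows "M = atomic I (\<lambda>i. measure M {q i}) q"
proof (rule measure_eqI)
  interpret prob_space M
    using assms by (simp add: discrete_prob_measure_def borel_prob_measure_def)
  have sets: "sets M = sets borel" and fin: "finite (measure_support M)"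
    using assms by (simp_all add: discrete_prob_measure_def borel_prob_measure_def)
  have I: "finite I"
    using fin assms(2) bij_betw_finite by blast
  show "sets M = sets (atomic I (\<lambda>i. measure M {q i}) q)"
    by (simp add: sets)
  fix A assume "A \<in> sets M"
  have "emeasure M A = emeasure M (A \<inter> measure_support M)"
    using emeasure_Diff_null_set[OF compl_measure_support_in_null_sets[OF sets] \<open>A \<in> sets M\<close>]
    by (simp add: Diff_Compl)
  also have "\<dots> = (\<Sum>y\<in>A \<inter> measure_support M. emeasure M {y})"
    using fin sets by (intro emeasure_eq_sum_singleton) auto
  also have "\<dots> = (\<Sum>y\<in>measure_support M. emeasure M {y} * indicator A y)"
    using fin by (simp add: indicator_def if_distrib Int_commute[of A] sum.inter_restrict cong: if_cong)
  also have "\<dots> = (\<Sum>i\<in>I. emeasure M {q i} * indicator A (q i))"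
    by (rule sum.reindex_bij_betw[OF assms(2), symmetric])
  also have "\<dots> = emeasure (atomic I (\<lambda>i. measure M {q i}) q) A"
    using I \<open>A \<in> sets M\<close> sets by (simp add: emeasure_atomic emeasure_eq_measure)
  finally show "emeasure M A = emeasure (atomic I (\<lambda>i. measure M {q i}) q) A" .
qed

lemma sum_measure_support_singleton:
  fixes M :: "'a::euclidean_space measure"
  assumes "discrete_prob_measure M"
  shows "(\<Sum>q\<in>measure_support M. measure M {q}) = 1"
proof -
  interpret prob_space M
    using assms by (simp add: discrete_prob_measure_def borel_prob_measure_def)
  have sets: "sets M = sets borel" and fin: "finite (measure_support M)"
    using assms by (simp_all add: discrete_prob_measure_def borel_prob_measure_def)
  have "(\<Sum>q\<in>measure_support M. measure M {q}) = measure M (measure_support M)"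
    using fin sets by (intro measure_eq_sum_singleton[symmetric]) auto
  also have "\<dots> = 1"
    using emeasure_Diff_null_set[OF compl_measure_support_in_null_sets[OF sets] sets.top]
      sets_eq_imp_space_eq[OF sets] emeasure_space_1
    by (simp add: Diff_Compl measure_def)
  finally show ?thesis .
qed

text \<open>The points that carry positive mass form a finite, hence closed set, and its complement
  is an open null set. Sparsity only needs this upper bound on the support.\<close>

lemma measure_support_atomic:
  fixes p :: "'i \<Rightarrow> 'a::t1_space"
  assumes "finite I"
  shows "measure_support (atomic I a p) \<subseteq> p ` {i \<in> I. a i > 0}"
proof
  fix q assume q: "q \<in> measure_support (atomic I a p)"
  let ?U = "- (p ` {i \<in> I. a i > 0})"
  have U: "open ?U"
    using assms by (intro open_Compl finite_imp_closed) auto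
  have "ennreal (a i) * indicator ?U (p i) = 0" if "i \<in> I" for i
    using that by (cases "a i > 0") (auto simp: ennreal_neg indicator_def)
  then have "(\<Sum>i\<in>I. ennreal (a i) * indicator ?U (p i)) = 0"
    by (intro sum.neutral) blast
  then have "emeasure (atomic I a p) ?U = 0"
    by (subst emeasure_atomic[OF assms borel_open[OF U]])
  with q U show "q \<in> p ` {i \<in> I. a i > 0}"
    by (force simp: measure_support_def)
qed

section \<open>Gluing couplings\<close>

text \<open>\<open>f q p\<close> is the conditional probability of the second coordinate
  \<open>q\<close> given the first coordinate \<open>p\<close>. With finitely many \<open>q\<close>,
  one density per slice suffices: \<open>N q\<close>, the first marginal of \<open>\<gamma>\<close>
  restricted to \<open>UNIV \<times> {q}\<close>, is dominated by \<open>Q\<close>, and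
  \<open>f q\<close> is its density.\<close>

lemma coupling_disintegration:
  fixes Q M :: "'a::euclidean_space measure"
  assumes Q: "borel_prob_measure Q" and M: "discrete_prob_measure M" and \<gamma>: "\<gamma> \<in> couplings Q M"
  obtains f :: "'a \<Rightarrow> 'a \<Rightarrow> ennreal" where
    "\<And>q. f q \<in> borel_measurable borel"
    "AE p in Q. (\<Sum>q\<in>measure_support M. f q p) = 1"
    "\<And>q. q \<in> measure_support M \<Longrightarrow> (\<integral>\<^sup>+ p. f q p \<partial>Q) = ennreal (measure M {q})"
    "\<And>c. c \<in> borel_measurable (borel \<Otimes>\<^sub>M borel) \<Longrightarrow>
       (\<integral>\<^sup>+ u. c u \<partial>\<gamma>) = (\<integral>\<^sup>+ p. (\<Sum>q\<in>measure_support M. f q p * c (p, q)) \<partial>Q)"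
proof -
  define S where "S = measure_support M"
  interpret Q: prob_space Q
    using Q by (simp add: borel_prob_measure_def)
  interpret M: prob_space M
    using M by (simp add: discrete_prob_measure_def borel_prob_measure_def)
  have sQ[measurable_cong]: "sets Q = sets borel"
    using Q by (simp add: borel_prob_measure_def)
  have sM: "sets M = sets borel" and fin: "finite S"
    using M by (simp_all add: discrete_prob_measure_def borel_prob_measure_def S_def)
  have s\<gamma>[measurable_cong]: "sets \<gamma> = sets (borel \<Otimes>\<^sub>M borel)"
    and fst: "distr \<gamma> borel fst = Q" and snd: "distr \<gamma> borel snd = M"
    using \<gamma> by (simp_all add: couplings_def)
  have sp: "space \<gamma> = UNIV" "space Q = UNIV"
    using sets_eq_imp_space_eq[OF s\<gamma>] sets_eq_imp_space_eq[OF sQ] by (simp_all add: space_pair_measure)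
  have fst_\<gamma>: "emeasure \<gamma> (A \<times> UNIV) = emeasure Q A" if "A \<in> sets borel" for A
  proof -
    have "fst -` A \<inter> space \<gamma> = A \<times> UNIV" by (auto simp: sp)
    then show ?thesis using that by (subst fst[symmetric], subst emeasure_distr) auto
  qed
  have snd_\<gamma>: "emeasure \<gamma> (UNIV \<times> A) = emeasure M A" if "A \<in> sets borel" for A
  proof -
    have "snd -` A \<inter> space \<gamma> = UNIV \<times> A" by (auto simp: sp)
    then show ?thesis using that by (subst snd[symmetric], subst emeasure_distr) auto
  qed
  have [measurable]: "UNIV \<times> {q} \<in> sets (borel \<Otimes>\<^sub>M borel)" for q :: 'a
    by (rule pair_measureI) auto
  define N where "N q = distr (density \<gamma> (indicator (UNIV \<times> {q}))) borel fst" for q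
  have N_int: "(\<integral>\<^sup>+ p. g p \<partial>N q) = (\<integral>\<^sup>+ u. indicator (UNIV \<times> {q}) u * g (fst u) \<partial>\<gamma>)"
    if [measurable]: "g \<in> borel_measurable borel" for g q
    unfolding N_def by (subst nn_integral_distr) (simp_all add: nn_integral_density)
  have sN: "sets (N q) = sets Q" for q by (simp add: N_def sQ)
  have N_emeasure: "emeasure (N q) A = emeasure \<gamma> (A \<times> {q})" if [measurable]: "A \<in> sets borel" for A q
  proof -
    have [measurable]: "A \<times> {q} \<in> sets (borel \<Otimes>\<^sub>M borel)"
      by (rule pair_measureI) auto
    have "emeasure (N q) A = (\<integral>\<^sup>+ u. indicator (UNIV \<times> {q}) u * indicator A (fst u) \<partial>\<gamma>)"
      using N_int[of "indicator A" q] that sN[of q] by (simp add: sQ)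
    also have "\<dots> = (\<integral>\<^sup>+ u. indicator (A \<times> {q}) u \<partial>\<gamma>)"
      by (intro nn_integral_cong) (auto simp: indicator_def)
    finally show ?thesis by simp
  qed
  have ac: "absolutely_continuous Q (N q)" for q
    unfolding absolutely_continuous_def
  proof
    fix A assume A: "A \<in> null_sets Q"
    then have [measurable]: "A \<in> sets borel" by (auto simp: sQ[symmetric])
    have "A \<times> UNIV \<in> sets (borel \<Otimes>\<^sub>M (borel :: 'a measure))" by (rule pair_measureI) auto
    then have "emeasure \<gamma> (A \<times> {q}) \<le> emeasure \<gamma> (A \<times> UNIV)"
      by (intro emeasure_mono) (auto simp: s\<gamma>)
    then show "A \<in> null_sets (N q)"
      using A fst_\<gamma>[of A] by (auto simp: null_sets_def N_emeasure sN)
  qed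
  define f where "f q = RN_deriv Q (N q)" for q
  have f[measurable]: "f q \<in> borel_measurable borel" for q
    using borel_measurable_RN_deriv[of Q "N q"] by (simp add: f_def measurable_cong_sets[OF sQ refl])
  have f_int: "(\<integral>\<^sup>+ p. g p \<partial>N q) = (\<integral>\<^sup>+ p. f q p * g p \<partial>Q)"
    if "g \<in> borel_measurable borel" for g q
    unfolding f_def using that
    by (intro Q.RN_deriv_nn_integral[OF ac sN]) (simp add: measurable_cong_sets[OF sQ refl])
  \<comment> \<open>Finitely many slices carry all of \<open>\<gamma>\<close>, so that integrals
    against \<open>\<gamma>\<close> split into integrals over slices.\<close>
  have AE_S: "AE u in \<gamma>. snd u \<in> S"
  proof (rule AE_I')
    have "emeasure \<gamma> (UNIV \<times> (- S)) = 0"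
      using snd_\<gamma>[of "- S"] compl_measure_support_in_null_sets[OF sM] by (auto simp: S_def sM null_sets_def)
    moreover have "UNIV \<times> (- S) \<in> sets (borel \<Otimes>\<^sub>M (borel :: 'a measure))"
      using fin by (intro pair_measureI) (auto intro: borel_open finite_imp_closed)
    ultimately show "UNIV \<times> (- S) \<in> null_sets \<gamma>"
      by (auto simp: null_sets_def s\<gamma>)
  qed auto
  have int: "(\<integral>\<^sup>+ u. c u \<partial>\<gamma>) = (\<integral>\<^sup>+ p. (\<Sum>q\<in>S. f q p * c (p, q)) \<partial>Q)"
    if c[measurable]: "c \<in> borel_measurable (borel \<Otimes>\<^sub>M borel)" for c
  proof -
    have "(\<integral>\<^sup>+ u. c u \<partial>\<gamma>) = (\<integral>\<^sup>+ u. (\<Sum>q\<in>S. indicator (UNIV \<times> {q}) u * c (fst u, q)) \<partial>\<gamma>)"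
      using AE_S
    proof (intro nn_integral_cong_AE, eventually_elim)
      fix u :: "'a \<times> 'a" assume u: "snd u \<in> S"
      have "(\<Sum>q\<in>S. indicator (UNIV \<times> {q}) u * c (fst u, q))
          = (\<Sum>q\<in>S. if q = snd u then c u else 0)"
        by (rule sum.cong) (auto simp: indicator_def mem_Times_iff)
      then show "c u = (\<Sum>q\<in>S. indicator (UNIV \<times> {q}) u * c (fst u, q))"
        using u fin by simp
    qed
    also have "\<dots> = (\<Sum>q\<in>S. \<integral>\<^sup>+ u. indicator (UNIV \<times> {q}) u * c (fst u, q) \<partial>\<gamma>)"
      by (intro nn_integral_sum) measurable
    also have "\<dots> = (\<Sum>q\<in>S. \<integral>\<^sup>+ p. f q p * c (p, q) \<partial>Q)"
      by (intro sum.cong refl, subst f_int[symmetric], measurable, subst N_int, measurable)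
    also have "\<dots> = (\<integral>\<^sup>+ p. (\<Sum>q\<in>S. f q p * c (p, q)) \<partial>Q)"
      by (intro nn_integral_sum[symmetric]) measurable
    finally show ?thesis .
  qed
  show thesis
  proof (rule that[of f])
    show "f q \<in> borel_measurable borel" for q by (rule f)
    show "(\<integral>\<^sup>+ p. f q p \<partial>Q) = ennreal (measure M {q})" if "q \<in> measure_support M" for q
    proof -
      have "(\<integral>\<^sup>+ p. f q p \<partial>Q) = (\<integral>\<^sup>+ p. 1 \<partial>N q)"
        using f_int[of "\<lambda>_. 1" q] by simp
      also have "\<dots> = emeasure (N q) UNIV"
        by (simp add: N_def)
      also have "\<dots> = emeasure M {q}"
        by (simp add: N_emeasure snd_\<gamma>)
      finally show ?thesis by (simp add: M.emeasure_eq_measure)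
    qed
    show "(\<integral>\<^sup>+ u. c u \<partial>\<gamma>) = (\<integral>\<^sup>+ p. (\<Sum>q\<in>measure_support M. f q p * c (p, q)) \<partial>Q)"
      if "c \<in> borel_measurable (borel \<Otimes>\<^sub>M borel)" for c
      using int[OF that] by (simp add: S_def)
    \<comment> \<open>Both sides are densities of \<open>Q\<close> with respect to itself:
      integrating the sum over \<open>A\<close> gives the mass of \<open>A \<times> UNIV\<close>
      under \<open>\<gamma>\<close>, which is that of \<open>A\<close> under
      \<open>Q\<close>.\<close>
    show "AE p in Q. (\<Sum>q\<in>measure_support M. f q p) = 1"
    proof (rule Q.density_unique_finite_measure)
      fix A assume A: "A \<in> sets Q"
      then have A'[measurable]: "A \<in> sets borel" by (simp add: sQ)
      have m: "A \<times> UNIV \<in> sets (borel \<Otimes>\<^sub>M (borel :: 'a measure))" by (rule pair_measureI) auto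
      have "(\<integral>\<^sup>+ p. (\<Sum>q\<in>S. f q p) * indicator A p \<partial>Q)
          = (\<integral>\<^sup>+ p. (\<Sum>q\<in>S. f q p * indicator (A \<times> UNIV) (p, q)) \<partial>Q)"
        by (simp add: sum_distrib_right indicator_times)
      also have "\<dots> = (\<integral>\<^sup>+ u. indicator (A \<times> UNIV) u \<partial>\<gamma>)"
        using m by (intro int[symmetric]) simp
      also have "\<dots> = emeasure Q A"
        using m by (simp add: fst_\<gamma> s\<gamma>)
      finally show "(\<integral>\<^sup>+ p. (\<Sum>q\<in>measure_support M. f q p) * indicator A p \<partial>Q)
          = (\<integral>\<^sup>+ p. 1 * indicator A p \<partial>Q)"
        using A by (simp add: S_def)
    qed auto
  qed
qed

section \<open>Multimarginal weights\<close>

definition multimarginals :: "nat \<Rightarrow> (nat \<Rightarrow> 'a::euclidean_space measure) \<Rightarrow> ((nat \<Rightarrow> 'a) \<Rightarrow> real) set" where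
  "multimarginals n P = {W. (\<forall>t\<in>support_tuples n P. 0 \<le> W t) \<and>
     (\<forall>i\<in>{1..n}. \<forall>q\<in>measure_support (P i).
        (\<Sum>t | t \<in> support_tuples n P \<and> t i = q. W t) = measure (P i) {q})}"

lemma finite_support_tuples:
  "(\<And>i. i \<in> {1..n} \<Longrightarrow> discrete_prob_measure (P i)) \<Longrightarrow> finite (support_tuples n P)"
  unfolding support_tuples_def by (intro finite_PiE) (auto simp: discrete_prob_measure_def)

lemma tuple_cost_nonneg:
  "(\<And>i. i \<in> {1..n} \<Longrightarrow> 0 \<le> lam i) \<Longrightarrow> 0 \<le> tuple_cost n lam t"
  unfolding tuple_cost_def by (intro sum_nonneg mult_nonneg_nonneg) auto

text \<open>Given \<open>p\<close>, the second coordinates are drawn independently from the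
  conditional distributions \<open>f i\<close>; averaging over \<open>Q\<close> yields
  \<open>W\<close>. At fixed \<open>p\<close>, the cost does not increase when \<open>p\<close> is
  replaced by the weighted mean of each tuple.\<close>

lemma multimarginal_of_couplings:
  fixes P :: "nat \<Rightarrow> 'a::euclidean_space measure"
  assumes P: "\<And>i. i \<in> {1..n} \<Longrightarrow> discrete_prob_measure (P i)"
    and lam_pos: "\<And>i. i \<in> {1..n} \<Longrightarrow> lam i > 0"
    and lam_sum: "(\<Sum>i=1..n. lam i) = 1"
    and Q: "borel_prob_measure Q"
    and \<gamma>: "\<And>i. i \<in> {1..n} \<Longrightarrow> \<gamma> i \<in> couplings Q (P i)"
  shows "\<exists>W\<in>multimarginals n P. ennreal (\<Sum>t\<in>support_tuples n P. tuple_cost n lam t * W t)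
    \<le> (\<Sum>i=1..n. ennreal (lam i) * (\<integral>\<^sup>+ u. ennreal ((norm (fst u - snd u))\<^sup>2) \<partial>\<gamma> i))"
proof -
  define T where "T = support_tuples n P"
  define S where "S i = measure_support (P i)" for i
  have T: "T = PiE {1..n} S"
    by (simp add: T_def S_def[abs_def] support_tuples_def)
  have finT: "finite T"
    unfolding T_def by (rule finite_support_tuples[OF P])
  have finS: "finite (S i)" if "i \<in> {1..n}" for i
    using P[OF that] by (simp add: S_def discrete_prob_measure_def)
  have n: "1 \<in> {1..n}"
    using lam_sum by (cases n) auto
  have sQ[measurable_cong]: "sets Q = sets borel"
    using Q by (simp add: borel_prob_measure_def)
  have "\<exists>f. \<forall>i\<in>{1..n}. (\<forall>q. f i q \<in> borel_measurable borel) \<and>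
    (AE p in Q. (\<Sum>q\<in>S i. f i q p) = 1) \<and>
    (\<forall>q\<in>S i. (\<integral>\<^sup>+ p. f i q p \<partial>Q) = ennreal (measure (P i) {q})) \<and>
    (\<forall>c\<in>borel_measurable (borel \<Otimes>\<^sub>M borel).
       (\<integral>\<^sup>+ u. c u \<partial>\<gamma> i) = (\<integral>\<^sup>+ p. (\<Sum>q\<in>S i. f i q p * c (p, q)) \<partial>Q))"
  proof (intro bchoice ballI)
    fix i assume i: "i \<in> {1..n}"
    show "\<exists>f. (\<forall>q. f q \<in> borel_measurable borel) \<and>
      (AE p in Q. (\<Sum>q\<in>S i. f q p) = 1) \<and>
      (\<forall>q\<in>S i. (\<integral>\<^sup>+ p. f q p \<partial>Q) = ennreal (measure (P i) {q})) \<and>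
      (\<forall>c\<in>borel_measurable (borel \<Otimes>\<^sub>M borel).
         (\<integral>\<^sup>+ u. c u \<partial>\<gamma> i) = (\<integral>\<^sup>+ p. (\<Sum>q\<in>S i. f q p * c (p, q)) \<partial>Q))"
      by (rule coupling_disintegration[OF Q P[OF i] \<gamma>[OF i]], rule exI)
        (intro conjI allI ballI; simp add: S_def)
  qed
  then obtain f :: "nat \<Rightarrow> 'a \<Rightarrow> 'a \<Rightarrow> ennreal" where
    f: "\<And>i q. i \<in> {1..n} \<Longrightarrow> f i q \<in> borel_measurable borel"
    and f1: "\<And>i. i \<in> {1..n} \<Longrightarrow> AE p in Q. (\<Sum>q\<in>S i. f i q p) = 1"
    and f_int: "\<And>i q. i \<in> {1..n} \<Longrightarrow> q \<in> S i \<Longrightarrow> (\<integral>\<^sup>+ p. f i q p \<partial>Q) = ennreal (measure (P i) {q})"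
    and f_c: "\<And>i c. i \<in> {1..n} \<Longrightarrow> c \<in> borel_measurable (borel \<Otimes>\<^sub>M borel) \<Longrightarrow>
       (\<integral>\<^sup>+ u. c u \<partial>\<gamma> i) = (\<integral>\<^sup>+ p. (\<Sum>q\<in>S i. f i q p * c (p, q)) \<partial>Q)"
    by blast
  have fQ: "f i q \<in> borel_measurable Q" if "i \<in> {1..n}" for i q
    using f[OF that] by (simp add: measurable_cong_sets[OF sQ refl])
  define F where "F t p = (\<Prod>i\<in>{1..n}. f i (t i) p)" for t p
  have F[measurable]: "F t \<in> borel_measurable Q" for t
    unfolding F_def using fQ by measurable
  define W where "W t = enn2real (\<integral>\<^sup>+ p. F t p \<partial>Q)" for t
  \<comment> \<open>The marginal identity for \<open>F\<close> needs all \<open>n\<close>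
    normalizations at the same \<open>p\<close>; finitely many exceptional null sets can be
    discarded together.\<close>
  have AE_all: "AE p in Q. \<forall>i\<in>{1..n}. (\<Sum>q\<in>S i. f i q p) = 1"
    by (rule AE_finite_allI) (use f1 in auto)
  have marg: "(\<Sum>t\<in>T. F t p * g (t i)) = (\<Sum>q\<in>S i. f i q p * g q)"
    if "\<forall>i\<in>{1..n}. (\<Sum>q\<in>S i. f i q p) = 1" "i \<in> {1..n}" for p i g
    unfolding T F_def by (rule sum_prod_PiE_marginal) (use that finS in auto)
  have F_marg: "(\<Sum>t | t \<in> T \<and> t i = q. \<integral>\<^sup>+ p. F t p \<partial>Q) = ennreal (measure (P i) {q})"
    if i: "i \<in> {1..n}" and q: "q \<in> S i" for i q
  proof -
    have "(\<Sum>t | t \<in> T \<and> t i = q. \<integral>\<^sup>+ p. F t p \<partial>Q) = (\<integral>\<^sup>+ p. (\<Sum>t | t \<in> T \<and> t i = q. F t p) \<partial>Q)"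
      by (rule nn_integral_sum[symmetric]) (rule F)
    also have "\<dots> = (\<integral>\<^sup>+ p. f i q p \<partial>Q)"
    proof (rule nn_integral_cong_AE, use AE_all in eventually_elim)
      fix p assume p: "\<forall>i\<in>{1..n}. (\<Sum>q\<in>S i. f i q p) = 1"
      have "(\<Sum>t | t \<in> T \<and> t i = q. F t p) = (\<Sum>t\<in>T. F t p * (if t i = q then 1 else 0))"
        using finT by (simp add: sum.inter_filter if_distrib cong: if_cong)
      also have "\<dots> = (\<Sum>b\<in>S i. f i b p * (if b = q then 1 else 0))"
        by (rule marg[OF p i])
      also have "\<dots> = f i q p"
        using q finS[OF i] by (simp add: if_distrib cong: if_cong)
      finally show "(\<Sum>t | t \<in> T \<and> t i = q. F t p) = f i q p" .
    qed
    also have "\<dots> = ennreal (measure (P i) {q})"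
      by (rule f_int[OF i q])
    finally show ?thesis .
  qed
  \<comment> \<open>The passage to reals loses nothing: the integral is one term of a first-marginal
    sum, which is finite.\<close>
  have W: "ennreal (W t) = (\<integral>\<^sup>+ p. F t p \<partial>Q)" if t: "t \<in> T" for t
  proof -
    have "t 1 \<in> S 1" using t n by (auto simp: T)
    moreover have "(\<integral>\<^sup>+ p. F t p \<partial>Q) \<le> (\<Sum>t' | t' \<in> T \<and> t' 1 = t 1. \<integral>\<^sup>+ p. F t' p \<partial>Q)"
      by (rule member_le_sum) (use t finT in auto)
    ultimately have "(\<integral>\<^sup>+ p. F t p \<partial>Q) \<le> ennreal (measure (P 1) {t 1})"
      using F_marg[OF n] by simp
    then show ?thesis
      unfolding W_def by (intro ennreal_enn2real) (auto intro: le_less_trans)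
  qed
  have W0: "0 \<le> W t" for t by (simp add: W_def)
  have "(\<Sum>t | t \<in> T \<and> t i = q. W t) = measure (P i) {q}" if "i \<in> {1..n}" "q \<in> S i" for i q
  proof -
    have "ennreal (\<Sum>t | t \<in> T \<and> t i = q. W t) = (\<Sum>t | t \<in> T \<and> t i = q. \<integral>\<^sup>+ p. F t p \<partial>Q)"
      using W0 W by (subst sum_ennreal[symmetric]) auto
    then show ?thesis
      using F_marg[OF that] W0 by (simp add: sum_nonneg)
  qed
  then have "W \<in> multimarginals n P"
    using W0 by (simp add: multimarginals_def T_def S_def)
  moreover have "ennreal (\<Sum>t\<in>T. tuple_cost n lam t * W t)
    \<le> (\<Sum>i=1..n. ennreal (lam i) * (\<integral>\<^sup>+ u. ennreal ((norm (fst u - snd u))\<^sup>2) \<partial>\<gamma> i))"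
  proof -
    define g where "g p q = ennreal ((norm (p - q))\<^sup>2)" for p q :: 'a
    have g[measurable]: "(\<lambda>p. g p q) \<in> borel_measurable borel" for q
      unfolding g_def by measurable
    have c0: "0 \<le> tuple_cost n lam t" for t :: "nat \<Rightarrow> 'a"
      by (rule tuple_cost_nonneg) (simp add: lam_pos less_imp_le)
    have "ennreal (\<Sum>t\<in>T. tuple_cost n lam t * W t)
        = (\<Sum>t\<in>T. (\<integral>\<^sup>+ p. F t p * ennreal (tuple_cost n lam t) \<partial>Q))"
      using c0 W0 by (subst sum_ennreal[symmetric])
        (auto simp: ennreal_mult W nn_integral_multc mult.commute intro!: sum.cong)
    also have "\<dots> = (\<integral>\<^sup>+ p. (\<Sum>t\<in>T. F t p * ennreal (tuple_cost n lam t)) \<partial>Q)"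
      by (rule nn_integral_sum[symmetric]) measurable
    also have "\<dots> \<le> (\<integral>\<^sup>+ p. (\<Sum>i=1..n. ennreal (lam i) * (\<Sum>q\<in>S i. f i q p * g p q)) \<partial>Q)"
    proof (rule nn_integral_mono_AE, use AE_all in eventually_elim)
      fix p assume p: "\<forall>i\<in>{1..n}. (\<Sum>q\<in>S i. f i q p) = 1"
      have "(\<Sum>t\<in>T. F t p * ennreal (tuple_cost n lam t))
          \<le> (\<Sum>t\<in>T. F t p * (\<Sum>i=1..n. ennreal (lam i) * g p (t i)))"
      proof (intro sum_mono mult_left_mono)
        fix t :: "nat \<Rightarrow> 'a"
        have "(\<Sum>i=1..n. ennreal (lam i) * g p (t i)) = ennreal (\<Sum>i=1..n. lam i * (norm (p - t i))\<^sup>2)"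
          using lam_pos by (subst sum_ennreal[symmetric]) (auto simp: g_def ennreal_mult less_imp_le)
        then show "ennreal (tuple_cost n lam t) \<le> (\<Sum>i=1..n. ennreal (lam i) * g p (t i))"
          using sum_weighted_dist_ge_tuple_cost[OF less_imp_le[OF lam_pos] lam_sum, of t p]
          by (simp add: ennreal_leI)
      qed auto
      also have "\<dots> = (\<Sum>i=1..n. ennreal (lam i) * (\<Sum>t\<in>T. F t p * g p (t i)))"
        by (simp add: sum_distrib_left mult.left_commute) (rule sum.swap)
      \<comment> \<open>\<open>g p (t i)\<close> depends on the tuple only through its
        \<open>i\<close>-th component, so the sum over tuples collapses to one over the support of
        \<open>P i\<close>.\<close>
      also have "\<dots> = (\<Sum>i=1..n. ennreal (lam i) * (\<Sum>q\<in>S i. f i q p * g p q))"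
        by (intro sum.cong refl arg_cong2[where f = "(*)"] marg[OF p])
      finally show "(\<Sum>t\<in>T. F t p * ennreal (tuple_cost n lam t))
        \<le> (\<Sum>i=1..n. ennreal (lam i) * (\<Sum>q\<in>S i. f i q p * g p q))" .
    qed
    also have "\<dots> = (\<Sum>i=1..n. \<integral>\<^sup>+ p. ennreal (lam i) * (\<Sum>q\<in>S i. f i q p * g p q) \<partial>Q)"
      using fQ by (intro nn_integral_sum) (auto intro!: borel_measurable_times_ennreal borel_measurable_sum)
    also have "\<dots> = (\<Sum>i=1..n. ennreal (lam i) * (\<integral>\<^sup>+ p. (\<Sum>q\<in>S i. f i q p * g p q) \<partial>Q))"
      using fQ by (intro sum.cong refl nn_integral_cmult) (auto intro!: borel_measurable_times_ennreal borel_measurable_sum)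
    also have "\<dots> = (\<Sum>i=1..n. ennreal (lam i) * (\<integral>\<^sup>+ u. g (fst u) (snd u) \<partial>\<gamma> i))"
      by (intro sum.cong refl arg_cong2[where f = "(*)"], subst f_c) (auto simp: g_def)
    finally show ?thesis by (simp add: g_def)
  qed
  ultimately show ?thesis unfolding T_def by blast
qed

text \<open>The product weights, with independent components, are a witness.\<close>

lemma multimarginals_nonempty:
  assumes P: "\<And>i. i \<in> {1..n} \<Longrightarrow> discrete_prob_measure (P i)"
  shows "multimarginals n P \<noteq> {}"
proof -
  define T where "T = support_tuples n P"
  define S where "S i = measure_support (P i)" for i
  have T: "T = PiE {1..n} S"
    by (simp add: T_def S_def[abs_def] support_tuples_def)
  have finT: "finite T"
    unfolding T_def by (rule finite_support_tuples[OF P])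
  have finS: "finite (S i)" if "i \<in> {1..n}" for i
    using P[OF that] by (simp add: S_def discrete_prob_measure_def)
  define W where "W t = (\<Prod>i=1..n. measure (P i) {t i})" for t
  have "(\<Sum>t | t \<in> T \<and> t i = q. W t) = measure (P i) {q}" if i: "i \<in> {1..n}" and q: "q \<in> S i" for i q
  proof -
    have "(\<Sum>t | t \<in> T \<and> t i = q. W t) = (\<Sum>t\<in>T. W t * (if t i = q then 1 else 0))"
      using finT by (simp add: sum.inter_filter if_distrib cong: if_cong)
    also have "\<dots> = (\<Sum>b\<in>S i. measure (P i) {b} * (if b = q then 1 else 0))"
      unfolding T W_def
      by (rule sum_prod_PiE_marginal) (use i finS sum_measure_support_singleton[OF P] in \<open>auto simp: S_def\<close>)
    also have "\<dots> = measure (P i) {q}"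
      using q finS[OF i] by (simp add: if_distrib cong: if_cong)
    finally show ?thesis .
  qed
  moreover have "0 \<le> W t" for t
    unfolding W_def by (intro prod_nonneg) auto
  ultimately have "W \<in> multimarginals n P"
    by (simp add: multimarginals_def T_def S_def)
  then show ?thesis by blast
qed

text \<open>Values off \<open>support_tuples n P\<close> are unconstrained. Setting them to 0
  changes neither marginals nor cost and leads into a compact product of unit intervals and
  singletons, where the continuous cost attains its minimum.\<close>

lemma ex_optimal_multimarginal:
  fixes P :: "nat \<Rightarrow> 'a::euclidean_space measure" and c :: "(nat \<Rightarrow> 'a) \<Rightarrow> real"
  assumes P: "\<And>i. i \<in> {1..n} \<Longrightarrow> discrete_prob_measure (P i)" and n: "n \<ge> 1"
  shows "\<exists>W\<in>multimarginals n P. \<forall>V\<in>multimarginals n P.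
    (\<Sum>t\<in>support_tuples n P. c t * W t) \<le> (\<Sum>t\<in>support_tuples n P. c t * V t)"
proof -
  define T where "T = support_tuples n P"
  have finT: "finite T"
    unfolding T_def by (rule finite_support_tuples[OF P])
  define B :: "(nat \<Rightarrow> 'a) \<Rightarrow> real set" where "B t = (if t \<in> T then {0..1} else {0})" for t
  define K where "K = PiE UNIV B \<inter> multimarginals n P"
  have "compactin (product_topology (\<lambda>_. euclidean) UNIV) (PiE UNIV B)"
    unfolding compactin_PiE by (auto simp: B_def)
  then have compact: "compact (PiE UNIV B)"
    by (simp only: euclidean_product_topology compactin_euclidean_iff)
  have closed: "closed (multimarginals n P)"
  proof -
    have "multimarginals n P = (\<Inter>t\<in>T. {W. 0 \<le> W t}) \<inter>
      (\<Inter>i\<in>{1..n}. \<Inter>q\<in>measure_support (P i). {W. (\<Sum>t | t \<in> T \<and> t i = q. W t) = measure (P i) {q}})"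
      by (auto simp: multimarginals_def T_def)
    also have "closed \<dots>"
      by (intro closed_Int closed_INT ballI closed_Collect_le closed_Collect_eq continuous_intros)
        (auto intro!: continuous_on_sum)
    finally show ?thesis .
  qed
  have restrict: "(\<lambda>t. if t \<in> T then V t else 0) \<in> K" if V: "V \<in> multimarginals n P" for V
  proof -
    \<comment> \<open>The weight of a tuple is bounded by a point mass of the first marginal; here
      \<open>n \<ge> 1\<close> enters.\<close>
    have "V t \<le> 1" if t: "t \<in> T" for t
    proof -
      have q: "t 1 \<in> measure_support (P 1)"
        using t n by (auto simp: T_def support_tuples_def)
      interpret prob_space "P 1"
        using P[of 1] n by (simp add: discrete_prob_measure_def borel_prob_measure_def)
      have "V t \<le> (\<Sum>t' | t' \<in> T \<and> t' 1 = t 1. V t')"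
        by (rule member_le_sum) (use t finT V in \<open>auto simp: multimarginals_def T_def\<close>)
      also have "\<dots> = measure (P 1) {t 1}"
        using V q n by (simp add: multimarginals_def T_def)
      finally show ?thesis
        using prob_le_1[of "{t 1}"] by linarith
    qed
    moreover have "(\<lambda>t. if t \<in> T then V t else 0) \<in> multimarginals n P"
      using V by (simp add: multimarginals_def T_def cong: conj_cong)
    ultimately show ?thesis
      using V by (auto simp: K_def B_def multimarginals_def T_def)
  qed
  have "compact K"
    unfolding K_def using compact closed by (rule compact_Int_closed)
  moreover have "K \<noteq> {}"
    using restrict multimarginals_nonempty[of n P] P by blast
  moreover have "continuous_on K (\<lambda>W. \<Sum>t\<in>T. c t * W t)"
    by (intro continuous_intros) (auto intro: continuous_on_subset[OF continuous_on_product_coordinates])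
  ultimately have "\<exists>W\<in>K. \<forall>V\<in>K. (\<Sum>t\<in>T. c t * W t) \<le> (\<Sum>t\<in>T. c t * V t)"
    by (rule continuous_attains_inf)
  then obtain W where W: "W \<in> K" "\<And>V. V \<in> K \<Longrightarrow> (\<Sum>t\<in>T. c t * W t) \<le> (\<Sum>t\<in>T. c t * V t)"
    by blast
  have "(\<Sum>t\<in>T. c t * W t) \<le> (\<Sum>t\<in>T. c t * V t)" if "V \<in> multimarginals n P" for V
    using W(2)[OF restrict[OF that]] by (simp cong: sum.cong)
  with W(1) show ?thesis
    by (auto simp: K_def T_def)
qed

text \<open>The infima in the Wasserstein distances are taken separately for each \<open>i\<close>,
  so it suffices to bound the cost of an arbitrary choice of couplings; gluing them gives
  multimarginal weights of no larger cost.\<close>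

lemma barycenter_objective_ge:
  fixes P :: "nat \<Rightarrow> 'a::euclidean_space measure"
  assumes P: "\<And>i. i \<in> {1..n} \<Longrightarrow> discrete_prob_measure (P i)"
    and lam_pos: "\<And>i. i \<in> {1..n} \<Longrightarrow> lam i > 0"
    and lam_sum: "(\<Sum>i=1..n. lam i) = 1"
    and Q: "borel_prob_measure Q"
    and C: "\<And>W. W \<in> multimarginals n P \<Longrightarrow> C \<le> (\<Sum>t\<in>support_tuples n P. tuple_cost n lam t * W t)"
  shows "ennreal C \<le> barycenter_objective n P lam Q"
  unfolding barycenter_objective_def W2_squared_def
proof (rule le_sum_INF_ennreal)
  fix \<gamma> assume \<gamma>: "\<And>i. i \<in> {1..n} \<Longrightarrow> \<gamma> i \<in> couplings Q (P i)"
  obtain W where "W \<in> multimarginals n P"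
    "ennreal (\<Sum>t\<in>support_tuples n P. tuple_cost n lam t * W t)
      \<le> (\<Sum>i=1..n. ennreal (lam i) * (\<integral>\<^sup>+ u. ennreal ((norm (fst u - snd u))\<^sup>2) \<partial>\<gamma> i))"
    using multimarginal_of_couplings[of n P lam Q \<gamma>, OF P lam_pos lam_sum Q \<gamma>] by blast
  with C show "ennreal C \<le> (\<Sum>i=1..n. ennreal (lam i) * (\<integral>\<^sup>+ u. ennreal ((norm (fst u - snd u))\<^sup>2) \<partial>\<gamma> i))"
    by (meson ennreal_leI order_trans)
qed (use lam_pos in auto)

section \<open>The hybrid linear program\<close>

lemma ex_poly_mapping_lookup:
  assumes "finite K"
  shows "\<exists>p. Poly_Mapping.lookup p = (\<lambda>k. if k \<in> K then f k else 0)"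
proof -
  have "finite {k. (if k \<in> K then f k else 0) \<noteq> 0}"
    by (rule finite_subset[OF _ assms]) auto
  then show ?thesis
    by (intro exI[of _ "Poly_Mapping.Abs_poly_mapping (\<lambda>k. if k \<in> K then f k else 0)"]) simp
qed

lemma lookup_scaleR: "Poly_Mapping.lookup (r *\<^sub>R p) k = r *\<^sub>R Poly_Mapping.lookup p k"
proof -
  have "finite {k. r *\<^sub>R Poly_Mapping.lookup p k \<noteq> 0}"
    by (rule finite_subset[OF _ finite_keys[of p]]) (auto simp: in_keys_iff)
  then show ?thesis by (simp add: scaleR_poly_mapping_def)
qed

text \<open>For nonzero \<open>u\<close>, the point \<open>v\<close> is the midpoint of two distinct
  points of \<open>S\<close> and lies in their open segment.\<close>

lemma extreme_point_of_perturbation: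
  fixes v :: "'a::real_vector"
  assumes "v extreme_point_of S" "v + u \<in> S" "v - u \<in> S"
  shows "u = 0"
proof (rule ccontr)
  assume "u \<noteq> 0"
  have "v = midpoint (v + u) (v - u)"
    by (simp add: midpoint_def)
  moreover have "v + u \<noteq> v - u"
  proof
    assume "v + u = v - u"
    then have "2 *\<^sub>R u = 0" by (simp add: scaleR_2 eq_neg_iff_add_eq_0)
    with \<open>u \<noteq> 0\<close> show False by simp
  qed
  ultimately have "v \<in> open_segment (v + u) (v - u)"
    by (metis midpoint_in_open_segment)
  then show False
    using assms by (auto simp: extreme_point_of_def)
qed

section \<open>Index maps of components and weighted means\<close>

locale barycenter_lp = hybrid_lp n P lam x s X Hw Hy
  for n :: nat and P :: "nat \<Rightarrow> 'a::euclidean_space measure" and lam x s X Hw Hy +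
  assumes P: "\<And>i. i \<in> {1..n} \<Longrightarrow> discrete_prob_measure (P i)"
    and lam_pos: "\<And>i. i \<in> {1..n} \<Longrightarrow> lam i > 0"
    and lam_sum: "(\<Sum>i=1..n. lam i) = 1"
    and x: "\<And>i. i \<in> {1..n} \<Longrightarrow>
              bij_betw (x i) {1..card (measure_support (P i))} (measure_support (P i))"
    and s: "bij_betw s {1..card (support_tuples n P)} (support_tuples n P)"
    and X: "bij_betw X {1..card (weighted_means n P lam)} (weighted_means n P lam)"
    and partition: "Hw \<union> Hy = {1..card (support_tuples n P)}" "Hw \<inter> Hy = {}"
begin

text \<open>Turns conditions such as \<open>s h i = x i j\<close> into
  \<open>\<iota> i h = j\<close>, so that sums over tuples can be grouped by index.\<close>

definition \<iota> :: "nat \<Rightarrow> nat \<Rightarrow> nat" where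
  "\<iota> i h = inv_into (J i) (x i) (s h i)"

text \<open>Different tuples may have the same mean, so this map need not be injective; its fibres
  collect the tuples that share an atom.\<close>

definition \<kappa> :: "nat \<Rightarrow> nat" where
  "\<kappa> h = inv_into {1..card (weighted_means n P lam)} X (weighted_mean n lam (s h))"

lemma n_ge_1: "1 \<in> {1..n}"
  using lam_sum by (cases n) auto

lemma finite_J: "finite (J i)"
  by (simp add: J_def)

lemma finite_Hw: "finite Hw" and finite_Hy: "finite Hy"
  using partition(1) by (metis finite_Un finite_atLeastAtMost)+

lemma x_J: "i \<in> {1..n} \<Longrightarrow> bij_betw (x i) (J i) (measure_support (P i))"
  using x by (simp add: J_def)

lemma s_in: "h \<in> Hw \<union> Hy \<Longrightarrow> s h \<in> support_tuples n P"
  using s partition(1) by (metis bij_betwE)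

lemma \<iota>_in: "h \<in> Hw \<union> Hy \<Longrightarrow> i \<in> {1..n} \<Longrightarrow> \<iota> i h \<in> J i"
  and x_\<iota>: "h \<in> Hw \<union> Hy \<Longrightarrow> i \<in> {1..n} \<Longrightarrow> x i (\<iota> i h) = s h i"
proof -
  assume h: "h \<in> Hw \<union> Hy" and i: "i \<in> {1..n}"
  have "s h i \<in> measure_support (P i)"
    using s_in[OF h] i by (auto simp: support_tuples_def)
  then have "s h i \<in> x i ` J i"
    using x_J[OF i] by (simp add: bij_betw_def)
  then show "\<iota> i h \<in> J i" "x i (\<iota> i h) = s h i"
    unfolding \<iota>_def by (rule inv_into_into, rule f_inv_into_f)
qed

lemma \<iota>_iff:
  assumes "h \<in> Hw \<union> Hy" "i \<in> {1..n}" "j \<in> J i"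
  shows "s h i = x i j \<longleftrightarrow> \<iota> i h = j"
  using inj_on_eq_iff[OF bij_betw_imp_inj_on[OF x_J[OF assms(2)]] \<iota>_in[OF assms(1,2)] assms(3)]
  by (simp only: x_\<iota>[OF assms(1,2)])

lemma \<kappa>_in: "h \<in> Hw \<union> Hy \<Longrightarrow> \<kappa> h \<in> {1..card (weighted_means n P lam)}"
  and X_\<kappa>: "h \<in> Hw \<union> Hy \<Longrightarrow> X (\<kappa> h) = weighted_mean n lam (s h)"
proof -
  assume "h \<in> Hw \<union> Hy"
  then have "weighted_mean n lam (s h) \<in> X ` {1..card (weighted_means n P lam)}"
    using s_in X by (auto simp: weighted_means_def bij_betw_def)
  then show "\<kappa> h \<in> {1..card (weighted_means n P lam)}" "X (\<kappa> h) = weighted_mean n lam (s h)"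
    unfolding \<kappa>_def by (rule inv_into_into, rule f_inv_into_f)
qed

lemma \<kappa>_iff:
  assumes "h \<in> Hw \<union> Hy" "k \<in> {1..card (weighted_means n P lam)}"
  shows "X k = weighted_mean n lam (s h) \<longleftrightarrow> \<kappa> h = k"
  using inj_on_eq_iff[OF bij_betw_imp_inj_on[OF X] \<kappa>_in[OF assms(1)] assms(2)]
  by (auto simp only: X_\<kappa>[OF assms(1)])

lemma Sw_eq:
  assumes "i \<in> {1..n}" "j \<in> J i"
  shows "Sw i j = {h \<in> Hw. \<iota> i h = j}"
  using \<iota>_iff[of _ i j] assms by (auto simp: Sw_def)

lemma Sy_eq:
  assumes "i \<in> {1..n}" "j \<in> J i"
  shows "Sy i j = \<kappa> ` {h \<in> Hy. \<iota> i h = j}"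
proof -
  have "Sy i j = {k \<in> {1..card (weighted_means n P lam)}. \<exists>h\<in>Hy. \<kappa> h = k \<and> \<iota> i h = j}"
    unfolding Sy_def using \<kappa>_iff \<iota>_iff[of _ i j] assms
    by (intro Collect_cong conj_cong refl bex_cong) auto
  also have "\<dots> = \<kappa> ` {h \<in> Hy. \<iota> i h = j}"
    using \<kappa>_in by auto
  finally show ?thesis .
qed

lemma Ky_eq: "Ky = \<kappa> ` Hy"
proof
  show "Ky \<subseteq> \<kappa> ` Hy"
    by (auto simp: Ky_def Sy_eq simp del: atLeastAtMost_iff)
  \<comment> \<open>Any component of the tuple would do; the first one exists because the weights
    sum to 1.\<close>
  have "\<kappa> h \<in> Sy 1 (\<iota> 1 h)" if "h \<in> Hy" for h
    using that \<iota>_in n_ge_1 by (subst Sy_eq) auto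
  then show "\<kappa> ` Hy \<subseteq> Ky"
    unfolding Ky_def using n_ge_1 \<iota>_in by (fastforce simp del: atLeastAtMost_iff)
qed

lemma Sy_subset_Ky: "i \<in> {1..n} \<Longrightarrow> j \<in> J i \<Longrightarrow> Sy i j \<subseteq> Ky"
  by (auto simp: Ky_def)

lemma finite_Ky: "finite Ky"
  by (simp add: Ky_eq finite_Hy)

lemma finite_y_index: "finite y_index"
proof -
  have "y_index \<subseteq> (SIGMA i:{1..n}. J i \<times> Ky)"
    using Sy_subset_Ky by (auto simp: y_index_def)
  then show ?thesis
    by (rule finite_subset) (auto intro!: finite_SigmaI finite_J finite_Ky)
qed

lemma sum_d: "i \<in> {1..n} \<Longrightarrow> (\<Sum>j\<in>J i. d i j) = 1"
  unfolding d_def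
  using sum.reindex_bij_betw[OF x_J, of i "\<lambda>q. measure (P i) {q}"] sum_measure_support_singleton[OF P, of i]
  by simp

lemma sum_group_\<iota>:
  assumes "i \<in> {1..n}" "H \<subseteq> Hw \<union> Hy"
  shows "(\<Sum>j\<in>J i. \<Sum>h | h \<in> H \<and> \<iota> i h = j. g h) = (\<Sum>h\<in>H. g h)"
  using assms \<iota>_in finite_Hw finite_Hy
  by (intro sum.group) (auto simp: finite_J simp del: atLeastAtMost_iff intro: finite_subset)

lemma sum_group_\<kappa>:
  assumes "H \<subseteq> Hy"
  shows "(\<Sum>k\<in>Ky. \<Sum>h | h \<in> H \<and> \<kappa> h = k. g h) = (\<Sum>h\<in>H. g h)"
  using assms finite_Hy by (intro sum.group) (auto simp: finite_Ky Ky_eq intro: finite_subset)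

section \<open>The program over rectangular index sets\<close>

lemma lookup_y_eq_0:
  assumes "Poly_Mapping.keys y \<subseteq> y_index" "k \<notin> Sy i j"
  shows "Poly_Mapping.lookup y (i, j, k) = 0"
  using assms by (auto simp: y_index_def in_keys_iff)

text \<open>Since \<open>y\<close> vanishes off its index set, all sums over that set may be extended to rectangles.\<close>

lemma sum_Sy_eq:
  fixes g :: "nat \<Rightarrow> real"
  assumes "Poly_Mapping.keys y \<subseteq> y_index" "i \<in> {1..n}" "j \<in> J i"
  shows "(\<Sum>k\<in>Sy i j. g k * Poly_Mapping.lookup y (i, j, k))
       = (\<Sum>k\<in>Ky. g k * Poly_Mapping.lookup y (i, j, k))"
  using assms Sy_subset_Ky lookup_y_eq_0[OF assms(1)]
  by (intro sum.mono_neutral_left) (auto simp: finite_Ky simp del: atLeastAtMost_iff)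

lemma sum_Sy_pairs_eq:
  assumes "Poly_Mapping.keys y \<subseteq> y_index" "i \<in> {1..n}"
  shows "(\<Sum>j | (i, j) \<in> Sy_pairs k. Poly_Mapping.lookup y (i, j, k))
       = (\<Sum>j\<in>J i. Poly_Mapping.lookup y (i, j, k))"
  using assms lookup_y_eq_0[OF assms(1)]
  by (intro sum.mono_neutral_left) (auto simp: finite_J Sy_pairs_def)

text \<open>The key conditions make the sign constraints global and let the sums run over
  \<open>J i\<close> and \<open>Ky\<close>, independently of the other indices, so that they can be
  swapped freely.\<close>

lemma feasible_iff:
  "(w, y, z) \<in> feasible \<longleftrightarrow>
     Poly_Mapping.keys w \<subseteq> Hw \<and> Poly_Mapping.keys y \<subseteq> y_index \<and> Poly_Mapping.keys z \<subseteq> Ky \<and>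
     (\<forall>i\<in>{1..n}. \<forall>k\<in>Ky. (\<Sum>j\<in>J i. Poly_Mapping.lookup y (i, j, k)) = Poly_Mapping.lookup z k) \<and>
     (\<forall>i\<in>{1..n}. \<forall>j\<in>J i. (\<Sum>h | h \<in> Hw \<and> \<iota> i h = j. Poly_Mapping.lookup w h)
        + (\<Sum>k\<in>Ky. Poly_Mapping.lookup y (i, j, k)) = d i j) \<and>
     (\<forall>h. Poly_Mapping.lookup w h \<ge> 0) \<and> (\<forall>q. Poly_Mapping.lookup y q \<ge> 0)"
proof (cases "Poly_Mapping.keys w \<subseteq> Hw \<and> Poly_Mapping.keys y \<subseteq> y_index")
  case True
  have "(\<forall>h\<in>Hw. Poly_Mapping.lookup w h \<ge> 0) \<longleftrightarrow> (\<forall>h. Poly_Mapping.lookup w h \<ge> 0)"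
    using True by (metis in_keys_iff order_refl subsetD)
  moreover have "(\<forall>i\<in>{1..n}. \<forall>j\<in>J i. \<forall>k\<in>Sy i j. Poly_Mapping.lookup y (i, j, k) \<ge> 0)
      \<longleftrightarrow> (\<forall>q. Poly_Mapping.lookup y q \<ge> 0)"
  proof
    assume *: "\<forall>i\<in>{1..n}. \<forall>j\<in>J i. \<forall>k\<in>Sy i j. Poly_Mapping.lookup y (i, j, k) \<ge> 0"
    show "\<forall>q. Poly_Mapping.lookup y q \<ge> 0"
    proof
      fix q
      show "Poly_Mapping.lookup y q \<ge> 0"
      proof (cases "q \<in> y_index")
        case q: True
        then show ?thesis using * by (auto simp: y_index_def)
      next
        case False
        then have "Poly_Mapping.lookup y q = 0"
          using True by (auto simp: in_keys_iff)
        then show ?thesis by simp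
      qed
    qed
  qed auto
  ultimately show ?thesis
    using True sum_Sy_pairs_eq[of y] sum_Sy_eq[of y _ _ "\<lambda>_. 1"]
    by (simp add: feasible_def Sw_eq del: atLeastAtMost_iff)
qed (auto simp: feasible_def)

lemma objective_eq:
  assumes "Poly_Mapping.keys y \<subseteq> y_index"
  shows "objective (w, y, z) = (\<Sum>h\<in>Hw. tuple_cost n lam (s h) * Poly_Mapping.lookup w h)
     + (\<Sum>i=1..n. lam i * (\<Sum>j\<in>J i. \<Sum>k\<in>Ky. (norm (X k - x i j))\<^sup>2 * Poly_Mapping.lookup y (i, j, k)))"
  unfolding objective_def prod.case
  by (intro arg_cong2[where f = "(+)"] arg_cong2[where f = "(*)"] sum.cong refl sum_Sy_eq[OF assms])

text \<open>The disjoint sum keeps the two families of atoms apart even where \<open>Hw\<close> and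
  \<open>Ky\<close> contain the same number.\<close>

lemma lp_measure_eq_atomic:
  "lp_measure (w, y, z) = atomic (Hw <+> Ky)
     (case_sum (Poly_Mapping.lookup w) (Poly_Mapping.lookup z))
     (case_sum (\<lambda>h. weighted_mean n lam (s h)) X)"
  by (rule measure_eqI)
    (simp_all add: emeasure_lp_measure emeasure_atomic sum.Plus finite_Hw finite_Ky del: sum_mult_indicator)

section \<open>The measure of a feasible point\<close>

context
  fixes w y z
  assumes feas: "(w, y, z) \<in> feasible"
begin

lemma keys_le: "Poly_Mapping.keys w \<subseteq> Hw" "Poly_Mapping.keys y \<subseteq> y_index" "Poly_Mapping.keys z \<subseteq> Ky"
  using feas by (simp_all add: feasible_iff)

lemma w_nonneg: "0 \<le> Poly_Mapping.lookup w h"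
  and y_nonneg: "0 \<le> Poly_Mapping.lookup y q"
  using feas unfolding feasible_iff by blast+

lemma sum_y_eq_z:
  "i \<in> {1..n} \<Longrightarrow> k \<in> Ky \<Longrightarrow> (\<Sum>j\<in>J i. Poly_Mapping.lookup y (i, j, k)) = Poly_Mapping.lookup z k"
  using feas by (simp add: feasible_iff)

text \<open>The program has no sign constraint on \<open>z\<close>; the sign is inherited from
  \<open>y\<close> through the constraints for \<open>i = 1\<close>.\<close>

lemma z_nonneg: "0 \<le> Poly_Mapping.lookup z k"
proof (cases "k \<in> Ky")
  case True
  then show ?thesis
    using sum_y_eq_z[OF n_ge_1 True] by (metis sum_nonneg y_nonneg)
next
  case False
  with keys_le(3) have "Poly_Mapping.lookup z k = 0"
    by (auto simp: in_keys_iff)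
  then show ?thesis by simp
qed

lemma sum_w_plus_sum_y_eq_d:
  "i \<in> {1..n} \<Longrightarrow> j \<in> J i \<Longrightarrow> (\<Sum>h | h \<in> Hw \<and> \<iota> i h = j. Poly_Mapping.lookup w h)
        + (\<Sum>k\<in>Ky. Poly_Mapping.lookup y (i, j, k)) = d i j"
  using feas by (simp add: feasible_iff)

text \<open>Adding the mass constraints for \<open>i = 1\<close> over all \<open>j\<close> gives the
  total mass of \<open>P 1\<close>; after swapping sums, the part in \<open>y\<close> becomes
  \<open>z\<close>.\<close>

lemma sum_w_plus_sum_z_eq_1:
  "(\<Sum>h\<in>Hw. Poly_Mapping.lookup w h) + (\<Sum>k\<in>Ky. Poly_Mapping.lookup z k) = 1"
proof -
  have "(\<Sum>k\<in>Ky. Poly_Mapping.lookup z k) = (\<Sum>k\<in>Ky. \<Sum>j\<in>J 1. Poly_Mapping.lookup y (1, j, k))"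
    by (intro sum.cong refl sum_y_eq_z[OF n_ge_1, symmetric])
  also have "\<dots> = (\<Sum>j\<in>J 1. \<Sum>k\<in>Ky. Poly_Mapping.lookup y (1, j, k))"
    by (rule sum.swap)
  finally have "(\<Sum>h\<in>Hw. Poly_Mapping.lookup w h) + (\<Sum>k\<in>Ky. Poly_Mapping.lookup z k)
     = (\<Sum>j\<in>J 1. (\<Sum>h | h \<in> Hw \<and> \<iota> 1 h = j. Poly_Mapping.lookup w h)
        + (\<Sum>k\<in>Ky. Poly_Mapping.lookup y (1, j, k)))"
    using sum_group_\<iota>[OF n_ge_1 Un_upper1, of "Poly_Mapping.lookup w"] by (simp only: sum.distrib)
  also have "\<dots> = 1"
    using sum_d[OF n_ge_1] by (simp only: sum_w_plus_sum_y_eq_d[OF n_ge_1] cong: sum.cong)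
  finally show ?thesis .
qed

lemma objective_nonneg: "0 \<le> objective (w, y, z)"
  unfolding objective_eq[OF keys_le(2)]
  by (intro add_nonneg_nonneg sum_nonneg mult_nonneg_nonneg w_nonneg y_nonneg tuple_cost_nonneg)
    (auto simp: lam_pos less_imp_le)

lemma borel_prob_lp_measure: "borel_prob_measure (lp_measure (w, y, z))"
  unfolding borel_prob_measure_def
proof
  have "emeasure (lp_measure (w, y, z)) UNIV
      = ennreal (\<Sum>h\<in>Hw. Poly_Mapping.lookup w h) + ennreal (\<Sum>k\<in>Ky. Poly_Mapping.lookup z k)"
    by (simp add: lp_measure_eq_atomic emeasure_atomic sum.Plus finite_Hw finite_Ky
        sum_ennreal w_nonneg z_nonneg)
  also have "\<dots> = 1"
    by (subst ennreal_plus[symmetric])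
      (simp_all add: sum_nonneg w_nonneg z_nonneg sum_w_plus_sum_z_eq_1)
  finally show "prob_space (lp_measure (w, y, z))"
    by (intro prob_spaceI) (simp add: lp_measure_eq_atomic)
qed simp

lemma finite_second_moment_lp_measure: "finite_second_moment (lp_measure (w, y, z))"
  unfolding finite_second_moment_def lp_measure_eq_atomic
  by (subst nn_integral_atomic)
    (auto simp: finite_Hw finite_Ky ennreal_mult_less_top sum.Plus)

text \<open>The solution describes a coupling: mass \<open>w h\<close> moves from the mean of
  \<open>s h\<close> to its \<open>i\<close>-th component, mass \<open>y (i, j, k)\<close> from
  \<open>X k\<close> to \<open>x i j\<close>. The two families of equality constraints yield its two
  marginals. It need not be optimal, hence only an inequality.\<close>

lemma W2_squared_lp_measure_le:
  assumes i: "i \<in> {1..n}"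
  shows "W2_squared (lp_measure (w, y, z)) (P i) \<le> ennreal (
    (\<Sum>h\<in>Hw. (norm (weighted_mean n lam (s h) - s h i))\<^sup>2 * Poly_Mapping.lookup w h)
    + (\<Sum>j\<in>J i. \<Sum>k\<in>Ky. (norm (X k - x i j))\<^sup>2 * Poly_Mapping.lookup y (i, j, k)))"
proof -
  define I where "I = Hw <+> (J i \<times> Ky)"
  define a where "a = case_sum (Poly_Mapping.lookup w) (\<lambda>(j, k). Poly_Mapping.lookup y (i, j, k))"
  define p where "p = case_sum (\<lambda>h. (weighted_mean n lam (s h), s h i)) (\<lambda>(j, k). (X k, x i j))"
  define \<gamma> where "\<gamma> = atomic I a p"
  have I: "finite I"
    by (simp add: I_def finite_Hw finite_Ky finite_J)
  have sum_I: "(\<Sum>u\<in>I. ennreal (a u) * g (p u))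
      = (\<Sum>h\<in>Hw. ennreal (Poly_Mapping.lookup w h) * g (weighted_mean n lam (s h), s h i))
        + (\<Sum>j\<in>J i. \<Sum>k\<in>Ky. ennreal (Poly_Mapping.lookup y (i, j, k)) * g (X k, x i j))" for g
    by (simp add: I_def a_def p_def sum.Plus finite_Hw finite_Ky finite_J sum.cartesian_product split_beta)
  have "distr \<gamma> borel fst = lp_measure (w, y, z)"
  proof (rule measure_eqI)
    fix A assume "A \<in> sets (distr \<gamma> borel fst)"
    then have A: "A \<in> sets borel" by simp
    have "emeasure (distr \<gamma> borel fst) A = (\<Sum>u\<in>I. ennreal (a u) * indicator A (fst (p u)))"
      using A I by (simp add: \<gamma>_def distr_atomic emeasure_atomic borel_measurable_continuous_onI continuous_on_fst)
    also have "\<dots> = (\<Sum>h\<in>Hw. ennreal (Poly_Mapping.lookup w h) * indicator A (weighted_mean n lam (s h)))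
        + (\<Sum>j\<in>J i. \<Sum>k\<in>Ky. ennreal (Poly_Mapping.lookup y (i, j, k)) * indicator A (X k))"
      using sum_I[of "\<lambda>u. indicator A (fst u)"] by simp
    also have "(\<Sum>j\<in>J i. \<Sum>k\<in>Ky. ennreal (Poly_Mapping.lookup y (i, j, k)) * indicator A (X k))
        = (\<Sum>k\<in>Ky. (\<Sum>j\<in>J i. ennreal (Poly_Mapping.lookup y (i, j, k))) * indicator A (X k))"
      by (subst sum.swap) (simp add: sum_distrib_right)
    also have "\<dots> = (\<Sum>k\<in>Ky. ennreal (Poly_Mapping.lookup z k) * indicator A (X k))"
      by (intro sum.cong refl) (simp add: sum_ennreal y_nonneg sum_y_eq_z[OF i])
    finally show "emeasure (distr \<gamma> borel fst) A = emeasure (lp_measure (w, y, z)) A"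
      using A by (simp add: emeasure_lp_measure)
  qed simp
  moreover have "distr \<gamma> borel snd = P i"
  proof (rule measure_eqI)
    fix A assume "A \<in> sets (distr \<gamma> borel snd)"
    then have A: "A \<in> sets borel" by simp
    have "emeasure (distr \<gamma> borel snd) A = (\<Sum>u\<in>I. ennreal (a u) * indicator A (snd (p u)))"
      using A I by (simp add: \<gamma>_def distr_atomic emeasure_atomic borel_measurable_continuous_onI continuous_on_snd)
    also have "\<dots> = (\<Sum>h\<in>Hw. ennreal (Poly_Mapping.lookup w h) * indicator A (s h i))
        + (\<Sum>j\<in>J i. \<Sum>k\<in>Ky. ennreal (Poly_Mapping.lookup y (i, j, k)) * indicator A (x i j))"
      using sum_I[of "\<lambda>u. indicator A (snd u)"] by simp
    \<comment> \<open>The tuples are grouped by their \<open>i\<close>-th component to match the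
      form of the mass constraints.\<close>
    also have "(\<Sum>h\<in>Hw. ennreal (Poly_Mapping.lookup w h) * indicator A (s h i))
        = (\<Sum>j\<in>J i. \<Sum>h | h \<in> Hw \<and> \<iota> i h = j. ennreal (Poly_Mapping.lookup w h) * indicator A (s h i))"
      by (rule sum_group_\<iota>[symmetric]) (use i in auto)
    also have "\<dots> = (\<Sum>j\<in>J i. (\<Sum>h | h \<in> Hw \<and> \<iota> i h = j. ennreal (Poly_Mapping.lookup w h)) * indicator A (x i j))"
      unfolding sum_distrib_right using i
      by (intro sum.cong refl arg_cong2[where f = "(*)"]) (auto simp flip: x_\<iota> simp del: atLeastAtMost_iff)
    also have "\<dots> + (\<Sum>j\<in>J i. \<Sum>k\<in>Ky. ennreal (Poly_Mapping.lookup y (i, j, k)) * indicator A (x i j))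
        = (\<Sum>j\<in>J i. ennreal (d i j) * indicator A (x i j))"
      unfolding sum.distrib[symmetric] sum_distrib_right[symmetric] distrib_right[symmetric]
      by (intro sum.cong refl arg_cong2[where f = "(*)"])
        (simp add: sum_ennreal w_nonneg y_nonneg sum_nonneg sum_w_plus_sum_y_eq_d[OF i, symmetric])
    also have "\<dots> = emeasure (P i) A"
      using A by (subst discrete_prob_measure_eq_atomic[OF P[OF i] x_J[OF i]])
        (simp add: emeasure_atomic finite_J d_def)
    finally show "emeasure (distr \<gamma> borel snd) A = emeasure (P i) A" .
  next
    show "sets (distr \<gamma> borel snd) = sets (P i)"
      using P[OF i] by (simp add: discrete_prob_measure_def borel_prob_measure_def)
  qed
  ultimately have "\<gamma> \<in> couplings (lp_measure (w, y, z)) (P i)"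
    by (simp add: couplings_def \<gamma>_def borel_prod[symmetric])
  then have "W2_squared (lp_measure (w, y, z)) (P i) \<le> (\<integral>\<^sup>+ u. ennreal ((norm (fst u - snd u))\<^sup>2) \<partial>\<gamma>)"
    unfolding W2_squared_def by (rule INF_lower)
  also have "\<dots> = (\<Sum>u\<in>I. ennreal (a u) * ennreal ((norm (fst (p u) - snd (p u)))\<^sup>2))"
    unfolding \<gamma>_def using I
    by (intro nn_integral_atomic) (auto intro!: borel_measurable_continuous_onI continuous_intros)
  also have "\<dots> = ennreal (
    (\<Sum>h\<in>Hw. (norm (weighted_mean n lam (s h) - s h i))\<^sup>2 * Poly_Mapping.lookup w h)
    + (\<Sum>j\<in>J i. \<Sum>k\<in>Ky. (norm (X k - x i j))\<^sup>2 * Poly_Mapping.lookup y (i, j, k)))"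
    using sum_I[of "\<lambda>u. ennreal ((norm (fst u - snd u))\<^sup>2)"]
    by (simp add: ennreal_mult w_nonneg y_nonneg sum_nonneg mult.commute flip: sum_ennreal)
  finally show ?thesis .
qed

lemma barycenter_objective_lp_measure_le:
  "barycenter_objective n P lam (lp_measure (w, y, z)) \<le> ennreal (objective (w, y, z))"
proof -
  define u where "u i = (\<Sum>h\<in>Hw. (norm (weighted_mean n lam (s h) - s h i))\<^sup>2 * Poly_Mapping.lookup w h)" for i
  define v where "v i = (\<Sum>j\<in>J i. \<Sum>k\<in>Ky. (norm (X k - x i j))\<^sup>2 * Poly_Mapping.lookup y (i, j, k))" for i
  have nonneg: "0 \<le> u i" "0 \<le> v i" for i
    by (auto simp: u_def v_def w_nonneg y_nonneg intro!: sum_nonneg)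
  have "barycenter_objective n P lam (lp_measure (w, y, z)) \<le> (\<Sum>i=1..n. ennreal (lam i) * ennreal (u i + v i))"
    unfolding barycenter_objective_def u_def v_def
    by (intro sum_mono mult_left_mono W2_squared_lp_measure_le) auto
  also have "\<dots> = (\<Sum>i=1..n. ennreal (lam i * (u i + v i)))"
    using nonneg by (intro sum.cong refl ennreal_mult[symmetric]) (auto simp: lam_pos less_imp_le)
  also have "\<dots> = ennreal (\<Sum>i=1..n. lam i * (u i + v i))"
    using nonneg by (intro sum_ennreal) (auto simp: lam_pos less_imp_le)
  also have "(\<Sum>i=1..n. lam i * (u i + v i)) = (\<Sum>i=1..n. lam i * u i) + (\<Sum>i=1..n. lam i * v i)"
    by (simp add: distrib_left sum.distrib)
  \<comment> \<open>Interchanging the sums over \<open>i\<close> and \<open>h\<close> assembles the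
    distances of each tuple to its mean into its cost.\<close>
  also have "(\<Sum>i=1..n. lam i * u i) = (\<Sum>h\<in>Hw. tuple_cost n lam (s h) * Poly_Mapping.lookup w h)"
    unfolding u_def tuple_cost_def sum_distrib_left sum_distrib_right mult.assoc by (rule sum.swap)
  finally show ?thesis
    by (simp add: objective_eq[OF keys_le(2)] v_def)
qed

end

section \<open>From multimarginal weights to feasible points\<close>

lemma ex_feasible_of_multimarginal:
  assumes W: "W \<in> multimarginals n P"
  shows "\<exists>v\<in>feasible. objective v = (\<Sum>t\<in>support_tuples n P. tuple_cost n lam t * W t)"
proof -
  \<comment> \<open>Tuples in \<open>Hw\<close> keep their own weight, those in \<open>Hy\<close>
    are aggregated: \<open>y\<close> collects the weights of tuples with a given component and a
    given mean, \<open>z\<close> those of all tuples with a given mean.\<close>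
  define b where "b = (\<lambda>(i, j, k). \<Sum>h | h \<in> {h \<in> Hy. \<iota> i h = j} \<and> \<kappa> h = k. W (s h))"
  obtain w where w: "Poly_Mapping.lookup w = (\<lambda>h. if h \<in> Hw then W (s h) else 0)"
    by (rule exE[OF ex_poly_mapping_lookup[OF finite_Hw]])
  obtain y where y: "Poly_Mapping.lookup y = (\<lambda>q. if q \<in> y_index then b q else 0)"
    by (rule exE[OF ex_poly_mapping_lookup[OF finite_y_index]])
  obtain z where z: "Poly_Mapping.lookup z = (\<lambda>k. if k \<in> Ky then \<Sum>h | h \<in> Hy \<and> \<kappa> h = k. W (s h) else 0)"
    by (rule exE[OF ex_poly_mapping_lookup[OF finite_Ky]])
  have W0: "0 \<le> W (s h)" if "h \<in> Hw \<union> Hy" for h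
    using W s_in[OF that] by (simp add: multimarginals_def)
  have y_eq: "Poly_Mapping.lookup y (i, j, k) = b (i, j, k)" if "i \<in> {1..n}" "j \<in> J i" for i j k
  proof (cases "(i, j, k) \<in> y_index")
    case False
    then have "k \<notin> Sy i j" using that by (simp add: y_index_def)
    then have "b (i, j, k) = 0"
      using Sy_eq[OF that] by (auto simp: b_def intro!: sum.neutral)
    then show ?thesis using False by (simp add: y)
  qed (simp add: y)
  \<comment> \<open>\<open>s\<close> enumerates the tuples and \<open>Hw\<close>, \<open>Hy\<close>
    partition its indices. \<open>R\<close> allows both the marginals, where one component is
    prescribed, and the total cost.\<close>
  have sum_s: "(\<Sum>h | h \<in> Hw \<and> R (s h). g (s h)) + (\<Sum>h | h \<in> Hy \<and> R (s h). g (s h))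
      = (\<Sum>t | t \<in> support_tuples n P \<and> R t. g t)" for g :: "_ \<Rightarrow> real" and R
  proof -
    have "(\<Sum>h | h \<in> Hw \<and> R (s h). g (s h)) + (\<Sum>h | h \<in> Hy \<and> R (s h). g (s h))
        = (\<Sum>h | h \<in> Hw \<union> Hy \<and> R (s h). g (s h))"
      using finite_Hw finite_Hy partition(2)
      by (subst sum.union_disjoint[symmetric]) (auto intro!: sum.cong)
    also have "\<dots> = (\<Sum>t | t \<in> support_tuples n P \<and> R t. g t)"
      using s unfolding partition(1)
      by (intro sum.reindex_bij_betw bij_betw_Collect) auto
    finally show ?thesis .
  qed
  have feas: "(w, y, z) \<in> feasible"
    unfolding feasible_iff
  proof (intro conjI ballI allI)
    show "Poly_Mapping.keys w \<subseteq> Hw" "Poly_Mapping.keys y \<subseteq> y_index" "Poly_Mapping.keys z \<subseteq> Ky"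
      by (auto simp: in_keys_iff w y z split: if_splits)
    show "0 \<le> Poly_Mapping.lookup w h" for h
      by (simp add: w W0)
    show "0 \<le> Poly_Mapping.lookup y q" for q
      by (auto simp: y b_def W0 split: prod.split intro!: sum_nonneg)
  next
    fix i k assume i: "i \<in> {1..n}" and k: "k \<in> Ky"
    have "(\<Sum>j\<in>J i. Poly_Mapping.lookup y (i, j, k))
        = (\<Sum>j\<in>J i. \<Sum>h | h \<in> {h \<in> Hy. \<kappa> h = k} \<and> \<iota> i h = j. W (s h))"
      by (rule sum.cong) (auto simp: y_eq[OF i] b_def intro!: sum.cong)
    also have "\<dots> = (\<Sum>h | h \<in> Hy \<and> \<kappa> h = k. W (s h))"
      by (subst sum_group_\<iota>[OF i]) auto
    finally show "(\<Sum>j\<in>J i. Poly_Mapping.lookup y (i, j, k)) = Poly_Mapping.lookup z k"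
      by (simp add: z k)
  next
    fix i j assume i: "i \<in> {1..n}" and j: "j \<in> J i"
    have "(\<Sum>k\<in>Ky. Poly_Mapping.lookup y (i, j, k)) = (\<Sum>h | h \<in> Hy \<and> \<iota> i h = j. W (s h))"
      unfolding y_eq[OF i j] b_def prod.case by (rule sum_group_\<kappa>) auto
    also have "\<dots> = (\<Sum>h | h \<in> Hy \<and> s h i = x i j. W (s h))"
      using \<iota>_iff[OF _ i j] by (intro sum.cong) auto
    finally have 1: "(\<Sum>k\<in>Ky. Poly_Mapping.lookup y (i, j, k)) = (\<Sum>h | h \<in> Hy \<and> s h i = x i j. W (s h))" .
    have 2: "(\<Sum>h | h \<in> Hw \<and> \<iota> i h = j. Poly_Mapping.lookup w h) = (\<Sum>h | h \<in> Hw \<and> s h i = x i j. W (s h))"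
      using \<iota>_iff[OF _ i j] by (intro sum.cong) (auto simp: w)
    have "x i j \<in> measure_support (P i)"
      using x_J[OF i] j by (metis bij_betwE)
    then show "(\<Sum>h | h \<in> Hw \<and> \<iota> i h = j. Poly_Mapping.lookup w h)
        + (\<Sum>k\<in>Ky. Poly_Mapping.lookup y (i, j, k)) = d i j"
      unfolding 1 2 using W i sum_s[of W "\<lambda>t. t i = x i j"] by (simp add: multimarginals_def d_def)
  qed
  moreover have "objective (w, y, z) = (\<Sum>t\<in>support_tuples n P. tuple_cost n lam t * W t)"
  proof -
    \<comment> \<open>Aggregation preserves the cost: the distance travelled depends on the tuple
      only through \<open>\<kappa> h\<close> and \<open>\<iota> i h\<close>, the indices that
      \<open>y\<close> retains.\<close>
    have inner: "(\<Sum>j\<in>J i. \<Sum>k\<in>Ky. (norm (X k - x i j))\<^sup>2 * Poly_Mapping.lookup y (i, j, k))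
        = (\<Sum>h\<in>Hy. (norm (weighted_mean n lam (s h) - s h i))\<^sup>2 * W (s h))" if i: "i \<in> {1..n}" for i
    proof -
      have "(\<Sum>k\<in>Ky. (norm (X k - x i j))\<^sup>2 * Poly_Mapping.lookup y (i, j, k))
          = (\<Sum>h | h \<in> Hy \<and> \<iota> i h = j. (norm (weighted_mean n lam (s h) - s h i))\<^sup>2 * W (s h))"
        if j: "j \<in> J i" for j
      proof -
        have "(\<Sum>k\<in>Ky. (norm (X k - x i j))\<^sup>2 * Poly_Mapping.lookup y (i, j, k))
          = (\<Sum>k\<in>Ky. \<Sum>h | h \<in> {h \<in> Hy. \<iota> i h = j} \<and> \<kappa> h = k.
              (norm (weighted_mean n lam (s h) - s h i))\<^sup>2 * W (s h))"
          unfolding y_eq[OF i j] b_def prod.case sum_distrib_left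
          by (intro sum.cong refl) (auto simp: X_\<kappa> simp flip: x_\<iota>[OF _ i])
        also have "\<dots> = (\<Sum>h | h \<in> Hy \<and> \<iota> i h = j. (norm (weighted_mean n lam (s h) - s h i))\<^sup>2 * W (s h))"
          by (rule sum_group_\<kappa>) auto
        finally show ?thesis .
      qed
      then show ?thesis
        using sum_group_\<iota>[OF i, of Hy] by simp
    qed
    have "(\<Sum>i=1..n. lam i * (\<Sum>j\<in>J i. \<Sum>k\<in>Ky. (norm (X k - x i j))\<^sup>2 * Poly_Mapping.lookup y (i, j, k)))
       = (\<Sum>i=1..n. lam i * (\<Sum>h\<in>Hy. (norm (weighted_mean n lam (s h) - s h i))\<^sup>2 * W (s h)))"
      by (rule sum.cong) (simp_all add: inner del: atLeastAtMost_iff)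
    also have "\<dots> = (\<Sum>h\<in>Hy. tuple_cost n lam (s h) * W (s h))"
      unfolding tuple_cost_def sum_distrib_left sum_distrib_right mult.assoc by (rule sum.swap)
    finally have "objective (w, y, z)
        = (\<Sum>h\<in>Hw. tuple_cost n lam (s h) * W (s h)) + (\<Sum>h\<in>Hy. tuple_cost n lam (s h) * W (s h))"
      by (simp add: objective_eq[OF keys_le(2)[OF feas]] w)
    then show ?thesis
      using sum_s[of "\<lambda>t. tuple_cost n lam t * W t" "\<lambda>_. True"] by simp
  qed
  ultimately show ?thesis by blast
qed

section \<open>Number of positive masses at a vertex\<close>

text \<open>Multiplying \<open>w h\<close> by \<open>1 \<plusminus> r h\<close>, and \<open>z k\<close> together with all \<open>y (i, j, k)\<close> by \<open>1 \<plusminus> r k\<close>, preserves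
  the constraints that couple \<open>y\<close> and \<open>z\<close>; so only the mass constraints restrict \<open>r\<close>. For each \<open>i\<close> these
  add up to the same equation (conservation of the total mass), which replaces the one for \<open>j = 1\<close>.\<close>

lemma card_pos_vertex_le:
  assumes vertex: "(w, y, z) extreme_point_of feasible"
  shows "card {h \<in> Hw. Poly_Mapping.lookup w h > 0} + card {k \<in> Ky. Poly_Mapping.lookup z k > 0}
    \<le> Suc (\<Sum>i=1..n. card (J i) - 1)"
proof (rule ccontr)
  define A where "A = {h \<in> Hw. Poly_Mapping.lookup w h > 0}"
  define C where "C = {k \<in> Ky. Poly_Mapping.lookup z k > 0}"
  \<comment> \<open>\<open>None\<close> stands for conservation of the total mass,
    \<open>Some (i, j)\<close> for the mass constraint at \<open>(i, j)\<close>. Leaving out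
    \<open>j = 1\<close> brings the number of equations down to the sparsity bound.\<close>
  define E where "E = insert None (Some ` (SIGMA i:{1..n}. J i - {1}))"
  define a where "a e = (case e of
      None \<Rightarrow> case_sum (Poly_Mapping.lookup w) (Poly_Mapping.lookup z)
    | Some (i, j) \<Rightarrow> case_sum (\<lambda>h. if \<iota> i h = j then Poly_Mapping.lookup w h else 0)
        (\<lambda>k. Poly_Mapping.lookup y (i, j, k)))" for e
  assume "\<not> card {h \<in> Hw. Poly_Mapping.lookup w h > 0} + card {k \<in> Ky. Poly_Mapping.lookup z k > 0}
    \<le> Suc (\<Sum>i=1..n. card (J i) - 1)"
  then have less: "Suc (\<Sum>i=1..n. card (J i) - 1) < card A + card C"
    by (simp add: A_def C_def)
  have feas: "(w, y, z) \<in> feasible"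
    using vertex by (simp add: extreme_point_of_def)
  have fin: "finite A" "finite C"
    by (simp_all add: A_def C_def finite_Hw finite_Ky)
  have finE: "finite E"
    by (simp add: E_def finite_J)
  \<comment> \<open>Since the masses sum to 1, \<open>J i\<close> is nonempty: there is an index to
    omit, and the truncated subtraction \<open>card (J i) - 1\<close> is exact.\<close>
  have J1: "1 \<in> J i" if "i \<in> {1..n}" for i
    using sum_d[OF that] by (cases "card (measure_support (P i))") (auto simp: J_def)
  have "card E = Suc (\<Sum>i=1..n. card (J i) - 1)"
    unfolding E_def using J1
    by (subst card_insert_disjoint) (auto simp: finite_J card_image card_Diff_singleton
        simp del: atLeastAtMost_iff One_nat_def intro!: sum.cong)
  then have card: "card E < card (A <+> C)"
    using less fin by (simp add: card_Plus)
  obtain r where r: "\<And>e. e \<in> E \<Longrightarrow> (\<Sum>u\<in>A <+> C. a e u * r u) = 0"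
    and nz: "\<exists>u\<in>A <+> C. r u \<noteq> 0" and r_le: "\<And>u. u \<in> A <+> C \<Longrightarrow> \<bar>r u\<bar> \<le> 1"
    using ex_nontrivial_solution_le_1[OF finE _ card, of a] fin by auto
  \<comment> \<open>Only positive entries are perturbed; the extension by 0 lets the sums run over
    all of \<open>Hw\<close> and \<open>Ky\<close>.\<close>
  define rw where "rw h = (if h \<in> A then r (Inl h) else 0)" for h
  define rz where "rz k = (if k \<in> C then r (Inr k) else 0)" for k
  have rw_le: "\<bar>rw h\<bar> \<le> 1" and rz_le: "\<bar>rz k\<bar> \<le> 1" for h k
    using r_le[of "Inl h"] r_le[of "Inr k"] by (auto simp: rw_def rz_def)
  have sum_a: "(\<Sum>u\<in>A <+> C. a e u * r u)
      = (\<Sum>h\<in>Hw. a e (Inl h) * rw h) + (\<Sum>k\<in>Ky. a e (Inr k) * rz k)" for e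
    using fin finite_Hw finite_Ky
    by (auto simp: sum.Plus rw_def rz_def A_def C_def split: if_splits
        intro!: arg_cong2[where f = "(+)"] sum.mono_neutral_cong_left)
  have mass: "(\<Sum>h | h \<in> Hw \<and> \<iota> i h = j. Poly_Mapping.lookup w h * rw h)
      + (\<Sum>k\<in>Ky. Poly_Mapping.lookup y (i, j, k) * rz k) = 0"
    (is "?S i j = 0") if i: "i \<in> {1..n}" and j: "j \<in> J i" for i j
  proof -
    have S_eq: "?S i j = (\<Sum>u\<in>A <+> C. a (Some (i, j)) u * r u)" for j
      unfolding sum_a using finite_Hw
      by (simp add: a_def sum.inter_filter if_distrib if_distribR cong: if_cong)
    have S0: "?S i j = 0" if "j \<in> J i - {1}" for j
      using r[of "Some (i, j)"] i that unfolding S_eq by (auto simp: E_def)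
    \<comment> \<open>This recovers the omitted equation: the sum over all \<open>j\<close> is the
      total mass equation, and every \<open>j\<close> other than 1 contributes 0.\<close>
    have "(\<Sum>j\<in>J i. ?S i j) = (\<Sum>h\<in>Hw. Poly_Mapping.lookup w h * rw h)
        + (\<Sum>k\<in>Ky. \<Sum>j\<in>J i. Poly_Mapping.lookup y (i, j, k) * rz k)"
      by (simp only: sum.distrib sum_group_\<iota>[OF i Un_upper1] sum.swap[of _ Ky])
    also have "(\<Sum>k\<in>Ky. \<Sum>j\<in>J i. Poly_Mapping.lookup y (i, j, k) * rz k)
        = (\<Sum>k\<in>Ky. Poly_Mapping.lookup z k * rz k)"
      unfolding sum_distrib_right[symmetric]
      by (intro sum.cong refl arg_cong2[where f = "(*)"] sum_y_eq_z[OF feas i])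
    also have "(\<Sum>h\<in>Hw. Poly_Mapping.lookup w h * rw h) + \<dots> = 0"
      using r[of None] unfolding sum_a by (simp add: a_def E_def)
    finally have "(\<Sum>j\<in>J i. ?S i j) = 0" .
    moreover have "(\<Sum>j\<in>J i - {1}. ?S i j) = 0"
      by (intro sum.neutral ballI S0)
    ultimately have "?S i 1 = 0"
      by (simp only: sum.remove[OF finite_J J1[OF i]] add_0_right)
    with S0 j show ?thesis by blast
  qed
  obtain dw where dw: "Poly_Mapping.lookup dw = (\<lambda>h. if h \<in> Hw then Poly_Mapping.lookup w h * rw h else 0)"
    by (rule exE[OF ex_poly_mapping_lookup[OF finite_Hw]])
  obtain dy where dy: "Poly_Mapping.lookup dy
      = (\<lambda>q. if q \<in> y_index then Poly_Mapping.lookup y q * rz (snd (snd q)) else 0)"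
    by (rule exE[OF ex_poly_mapping_lookup[OF finite_y_index]])
  obtain dz where dz: "Poly_Mapping.lookup dz = (\<lambda>k. if k \<in> Ky then Poly_Mapping.lookup z k * rz k else 0)"
    by (rule exE[OF ex_poly_mapping_lookup[OF finite_Ky]])
  have outside: "h \<notin> Hw \<Longrightarrow> Poly_Mapping.lookup w h = 0" "q \<notin> y_index \<Longrightarrow> Poly_Mapping.lookup y q = 0"
    "k \<notin> Ky \<Longrightarrow> Poly_Mapping.lookup z k = 0" for h q k
    using keys_le[OF feas] by (auto simp: in_keys_iff)
  \<comment> \<open>Both directions are treated at once, with \<open>\<rho>\<close> equal to 1 or
    -1; the bound 1 on the relative changes preserves the signs.\<close>
  have perturbed: "(w + \<rho> *\<^sub>R dw, y + \<rho> *\<^sub>R dy, z + \<rho> *\<^sub>R dz) \<in> feasible" if \<rho>: "\<bar>\<rho>\<bar> = 1" for \<rho> :: real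
  proof -
    have lookups: "Poly_Mapping.lookup (w + \<rho> *\<^sub>R dw) h = Poly_Mapping.lookup w h * (1 + \<rho> * rw h)"
      "Poly_Mapping.lookup (y + \<rho> *\<^sub>R dy) q = Poly_Mapping.lookup y q * (1 + \<rho> * rz (snd (snd q)))"
      "Poly_Mapping.lookup (z + \<rho> *\<^sub>R dz) k = Poly_Mapping.lookup z k * (1 + \<rho> * rz k)" for h q k
      using outside by (auto simp: lookup_add lookup_scaleR dw dy dz algebra_simps)
    have pos: "0 \<le> 1 + \<rho> * rw h" "0 \<le> 1 + \<rho> * rz k" for h k
      using rw_le[of h] rz_le[of k] \<rho> by (auto simp: abs_if split: if_splits)
    show ?thesis
      unfolding feasible_iff
    proof (intro conjI ballI allI)
      show "Poly_Mapping.keys (w + \<rho> *\<^sub>R dw) \<subseteq> Hw" "Poly_Mapping.keys (y + \<rho> *\<^sub>R dy) \<subseteq> y_index"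
        "Poly_Mapping.keys (z + \<rho> *\<^sub>R dz) \<subseteq> Ky"
        by (rule subsetI, rule ccontr, simp add: in_keys_iff lookups outside)+
      show "0 \<le> Poly_Mapping.lookup (w + \<rho> *\<^sub>R dw) h" for h
        unfolding lookups by (intro mult_nonneg_nonneg pos w_nonneg[OF feas])
      show "0 \<le> Poly_Mapping.lookup (y + \<rho> *\<^sub>R dy) q" for q
        unfolding lookups by (intro mult_nonneg_nonneg pos y_nonneg[OF feas])
    next
      fix i k assume i: "i \<in> {1..n}" and k: "k \<in> Ky"
      show "(\<Sum>j\<in>J i. Poly_Mapping.lookup (y + \<rho> *\<^sub>R dy) (i, j, k)) = Poly_Mapping.lookup (z + \<rho> *\<^sub>R dz) k"
        unfolding lookups snd_conv sum_distrib_right[symmetric] sum_y_eq_z[OF feas i k] ..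
    next
      fix i j assume i: "i \<in> {1..n}" and j: "j \<in> J i"
      have "(\<Sum>h | h \<in> Hw \<and> \<iota> i h = j. Poly_Mapping.lookup (w + \<rho> *\<^sub>R dw) h)
          + (\<Sum>k\<in>Ky. Poly_Mapping.lookup (y + \<rho> *\<^sub>R dy) (i, j, k))
        = ((\<Sum>h | h \<in> Hw \<and> \<iota> i h = j. Poly_Mapping.lookup w h) + (\<Sum>k\<in>Ky. Poly_Mapping.lookup y (i, j, k)))
          + \<rho> * ((\<Sum>h | h \<in> Hw \<and> \<iota> i h = j. Poly_Mapping.lookup w h * rw h)
            + (\<Sum>k\<in>Ky. Poly_Mapping.lookup y (i, j, k) * rz k))"
        by (simp add: lookups distrib_left sum.distrib sum_distrib_left mult.left_commute)
      then show "(\<Sum>h | h \<in> Hw \<and> \<iota> i h = j. Poly_Mapping.lookup (w + \<rho> *\<^sub>R dw) h)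
          + (\<Sum>k\<in>Ky. Poly_Mapping.lookup (y + \<rho> *\<^sub>R dy) (i, j, k)) = d i j"
        by (simp only: mass[OF i j] sum_w_plus_sum_y_eq_d[OF feas i j] mult_zero_right add_0_right)
    qed
  qed
  have "(dw, dy, dz) = 0"
    using perturbed[of 1] perturbed[of "-1"] by (intro extreme_point_of_perturbation[OF vertex]) simp_all
  then have zero: "dw = 0" "dz = 0"
    by (simp_all add: zero_prod_def)
  \<comment> \<open>A nonzero relative change of a positive entry is a nonzero change, so
    \<open>dw\<close> or \<open>dz\<close> cannot vanish.\<close>
  obtain u where u: "u \<in> A <+> C" "r u \<noteq> 0"
    using nz by blast
  then show False
  proof (cases u)
    case (Inl h)
    then have "Poly_Mapping.lookup dw h \<noteq> 0"
      using u by (auto simp: dw rw_def A_def)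
    with zero show False by simp
  next
    case (Inr k)
    then have "Poly_Mapping.lookup dz k \<noteq> 0"
      using u by (auto simp: dz rz_def C_def)
    with zero show False by simp
  qed
qed

section \<open>Optimality and sparsity\<close>

lemma barycenter_lp_correct:
  shows "\<exists>v. optimal v"
    and "optimal v \<Longrightarrow> is_barycenter n P lam (lp_measure v)"
    and "optimal_vertex v \<Longrightarrow> is_sparse_barycenter n P lam (lp_measure v)"
proof -
  have "n \<ge> 1" using n_ge_1 by simp
  then obtain W where W: "W \<in> multimarginals n P" "\<And>V. V \<in> multimarginals n P \<Longrightarrow>
      (\<Sum>t\<in>support_tuples n P. tuple_cost n lam t * W t) \<le> (\<Sum>t\<in>support_tuples n P. tuple_cost n lam t * V t)"
    using ex_optimal_multimarginal[of n P "tuple_cost n lam", OF P] by blast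
  obtain v0 where v0: "v0 \<in> feasible" "objective v0 = (\<Sum>t\<in>support_tuples n P. tuple_cost n lam t * W t)"
    using ex_feasible_of_multimarginal[OF W(1)] by blast
  have lower: "ennreal (objective v0) \<le> barycenter_objective n P lam Q" if "borel_prob_measure Q" for Q
    unfolding v0(2) by (rule barycenter_objective_ge[OF P lam_pos lam_sum that W(2)])
  have upper: "barycenter_objective n P lam (lp_measure v) \<le> ennreal (objective v)"
    and prob: "borel_prob_measure (lp_measure v)" and moment: "finite_second_moment (lp_measure v)"
    and nonneg: "0 \<le> objective v" if "v \<in> feasible" for v
    using that barycenter_objective_lp_measure_le borel_prob_lp_measure finite_second_moment_lp_measure
      objective_nonneg by (cases v; blast)+
  \<comment> \<open>The lower bound is applied to \<open>lp_measure v\<close> itself, whose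
    barycenter objective is in turn at most the LP value of \<open>v\<close>.\<close>
  have "objective v0 \<le> objective v" if "v \<in> feasible" for v
    using order_trans[OF lower[OF prob[OF that]] upper[OF that]] nonneg[OF that] by simp
  with v0 show "\<exists>v. optimal v"
    unfolding optimal_def by blast
  have bary: "is_barycenter n P lam (lp_measure v)" if "optimal v" for v
  proof -
    have v: "v \<in> feasible" and le: "objective v \<le> objective v0"
      using that v0 by (auto simp: optimal_def)
    \<comment> \<open>The LP value of \<open>v\<close> is at most that of \<open>v0\<close>, which
      bounds the objective at every \<open>Q\<close> from below.\<close>
    have "barycenter_objective n P lam (lp_measure v) \<le> barycenter_objective n P lam Q"
      if "borel_prob_measure Q" for Q
      using upper[OF v] ennreal_leI[OF le] lower[OF that] by (meson order_trans)
    then show ?thesis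
      using prob[OF v] moment[OF v] by (simp add: is_barycenter_def)
  qed
  then show "optimal v \<Longrightarrow> is_barycenter n P lam (lp_measure v)" .
  assume v: "optimal_vertex v"
  obtain w y z where v_eq: "v = (w, y, z)"
    by (cases v)
  define A where "A = {h \<in> Hw. Poly_Mapping.lookup w h > 0}"
  define C where "C = {k \<in> Ky. Poly_Mapping.lookup z k > 0}"
  have fin: "finite A" "finite C"
    by (simp_all add: A_def C_def finite_Hw finite_Ky)
  \<comment> \<open>Only positive masses produce support points, and coinciding means can only lower
    their number.\<close>
  have supp: "measure_support (lp_measure v) \<subseteq> case_sum (\<lambda>h. weighted_mean n lam (s h)) X ` (A <+> C)"
    unfolding v_eq lp_measure_eq_atomic
    by (rule order_trans[OF measure_support_atomic]) (auto simp: A_def C_def finite_Hw finite_Ky)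
  have "card (measure_support (lp_measure v)) \<le> card (A <+> C)"
    using fin by (intro order_trans[OF card_mono[OF _ supp] card_image_le]) auto
  also have "\<dots> = card A + card C"
    using fin by (simp add: card_Plus)
  also have "\<dots> \<le> Suc (\<Sum>i=1..n. card (J i) - 1)"
    using v card_pos_vertex_le[of w y z] by (simp add: A_def C_def optimal_vertex_def v_eq)
  finally have "int (card (measure_support (lp_measure v))) \<le> int (Suc (\<Sum>i=1..n. card (J i) - 1))"
    by (rule of_nat_mono)
  also have "\<dots> = (\<Sum>i=1..n. int (card (measure_support (P i)))) - int n + 1"
  proof -
    \<comment> \<open>Supports are nonempty, so natural and integer subtraction agree.\<close>
    have "int (card (J i) - 1) = int (card (measure_support (P i))) - 1" if "i \<in> {1..n}" for i
      using sum_d[OF that] by (cases "card (measure_support (P i))") (auto simp: J_def)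
    then show ?thesis
      by (simp add: sum_subtractf)
  qed
  finally show "is_sparse_barycenter n P lam (lp_measure v)"
    using bary[of v] v finite_subset[OF supp] fin
    by (simp add: is_sparse_barycenter_def optimal_vertex_def)
qed

end

theorem theorem4:
  fixes n :: nat
    and P :: "nat \<Rightarrow> (real ^ 'd) measure"
    and lam :: "nat \<Rightarrow> real"
    and x :: "nat \<Rightarrow> nat \<Rightarrow> real ^ 'd"
    and s :: "nat \<Rightarrow> nat \<Rightarrow> real ^ 'd"
    and X :: "nat \<Rightarrow> real ^ 'd"
    and Hw Hy :: "nat set"
  assumes P: "\<And>i. i \<in> {1..n} \<Longrightarrow> discrete_prob_measure (P i)"
    and lam_pos: "\<And>i. i \<in> {1..n} \<Longrightarrow> lam i > 0"
    and lam_sum: "(\<Sum>i=1..n. lam i) = 1"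
    and x: "\<And>i. i \<in> {1..n} \<Longrightarrow>
              bij_betw (x i) {1..card (measure_support (P i))} (measure_support (P i))"
    and s: "bij_betw s {1..card (support_tuples n P)} (support_tuples n P)"
    and X: "bij_betw X {1..card (weighted_means n P lam)} (weighted_means n P lam)"
    and partition: "Hw \<union> Hy = {1..card (support_tuples n P)}" "Hw \<inter> Hy = {}"
  shows "(\<exists>v. hybrid_lp.optimal n P lam x s X Hw Hy v) \<and>
         (\<forall>v. hybrid_lp.optimal n P lam x s X Hw Hy v \<longrightarrow>
            is_barycenter n P lam (hybrid_lp.lp_measure n P lam x s X Hw Hy v)) \<and>
         (\<forall>v. hybrid_lp.optimal_vertex n P lam x s X Hw Hy v \<longrightarrow>
            is_sparse_barycenter n P lam (hybrid_lp.lp_measure n P lam x s X Hw Hy v))"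
proof -
  interpret barycenter_lp n P lam x s X Hw Hy
    by unfold_locales (fact assms)+
  show ?thesis
    using barycenter_lp_correct by blast
qed

end
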